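(* Let $N\ge1$, let $\mu_{i,j}$ ($i,j\in\mathbb{N}$) be skew-symmetric bi-moments and $\beta^{(k)}_j$ ($j\in\mathbb{N}$, $k=1,\ldots,N$) single moments, all depending smoothly on times $t=(t_1,t_2,\ldots)$, with $$\partial_{t_n}\mu_{i,j}=\mu_{i+n,j}+\mu_{i,j+n},\qquad \partial_{t_n}\beta_j^{(k)}=\beta_{j+n}^{(k)}\qquad(n\ge1),$$ and assume $\tau_{2n}^{(m)}\ne0$, $\tau_{2n+1,k}^{(m)}\neq0$ for all $n,m\in\mathbb{N}$ and all $k$. Then for all $n,m\in\mathbb{N}$, $k\in\{1,\ldots,N\}$, $0\le\ell_1\le 2n+1$ and $0\le \ell_2\le 2n+2$, \begin{align*} &\tau_{2n}^{(m+1)}s_{2n+1-\ell_1}(-\tilde{\partial}_t)\tau_{2n+1,k}^{(m)}+\tau_{2n+1,k}^{(m+1)}s_{2n-\ell_1}(-\tilde{\partial}_t)\tau_{2n}^{(m)}\\ &\qquad=\tau_{2n+1,k}^{(m)}s_{2n+1-\ell_1}(-\tilde{\partial}_t)\tau_{2n}^{(m+1)}+\tau_{2n+2}^{(m)}s_{2n-\ell_1}(-\tilde{\partial}_t)\tau_{2n-1,k}^{(m+1)},\\ &\tau_{2n+1,k}^{(m+1)}s_{2n+2-\ell_2}(-\tilde{\partial}_t)\tau_{2n+2}^{(m)}+\tau_{2n+2}^{(m+1)}s_{2n+1-\ell_2}(-\tilde{\partial}_t)\tau_{2n+1,k}^{(m)}\\ &\qquad=\tau_{2n+2}^{(m)}s_{2n+2-\ell_2}(-\tilde{\partial}_t)\tau_{2n+1,k}^{(m+1)}+\tau_{2n+3,k}^{(m)}s_{2n+1-\ell_2}(-\tilde{\partial}_t)\tau_{2n}^{(m+1)}.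 \end{align*}
   Context: $\mathbb{N}=\{0,1,2,\ldots\}$; $\mu_{i,j}=-\mu_{j,i}$ and all moments are real-valued. Pfaffian notation: for labels $a_1,\ldots,a_{2M}$, $\mathrm{Pf}(a_1,\ldots,a_{2M})$ is the Pfaffian of the skew-symmetric matrix whose $(p,q)$ entry is $\mathrm{Pf}(a_p,a_q)=-\mathrm{Pf}(a_q,a_p)$; the empty Pfaffian is $1$. For integer labels $i,j$ and extra labels $d_1,\ldots,d_N$: $\mathrm{Pf}(i,j)=\mu_{i,j}$, $\mathrm{Pf}(d_k,i)=\beta_i^{(k)}$. Put $\tau_{2n}^{(m)}=\mathrm{Pf}(m,\ldots,m+2n-1)$ and $\tau_{2n+1,k}^{(m)}=\mathrm{Pf}(d_k,m,\ldots,m+2n)$, with $\tau_0^{(m)}=1$ and the convention $\tau_{-1,k}^{(m)}=0$. The (elementary) Schur polynomials $s_k$ are defined by $\exp\left(\sum_{l\ge1}t_l z^l\right)=\sum_{k\ge0}s_k(t)z^k$, with $s_k=0$ for $k<0$; $\tilde\partial_t=(\partial_{t_1},\tfrac12\partial_{t_2},\tfrac13\partial_{t_3},\ldots)$, and $s_k(-\tilde\partial_t)$ is the differential operator obtained by substituting $t_l\mapsto-\tfrac1l\partial_{t_l}$ in $s_k$. *)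

theory Defs
  imports
    "HOL-Analysis.Analysis"
    "HOL-Combinatorics.Permutations"
    "HOL-Computational_Algebra.Formal_Power_Series"
    "HOL-Library.Poly_Mapping"
begin

section \<open>Functions of the times\<close>

text \<open>
  A point \<open>t\<close> lists the times as \<open>t l\<close> for \<open>l \<ge> 1\<close>. The coordinate \<open>t 0\<close> is not a time:
  no hypothesis or conclusion involves a derivative in it.
\<close>

type_synonym times = "nat \<Rightarrow> real"

definition partial :: "nat \<Rightarrow> (times \<Rightarrow> real) \<Rightarrow> times \<Rightarrow> real" where
  "partial l f t = deriv (\<lambda>x. f (t(l := x))) (t l)"

text \<open>The points that differ from \<open>t\<close> only in the coordinates in \<open>L\<close>.\<close>

definition slice :: "nat set \<Rightarrow> times \<Rightarrow> times set" where
  "slice L t = {u. \<forall>l. l \<notin> L \<longrightarrow> u l = t l}"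

text \<open>
  Openness and smoothness refer to finitely many times at once. Openness or continuity in the
  product topology would be too restrictive: the series \<open>\<Sum>l. t l * x ^ l\<close> that occurs in
  moments of exponential weights converges on no nonempty product-open set when \<open>x \<noteq> 0\<close>.
\<close>

definition finitely_open :: "times set \<Rightarrow> bool" where
  "finitely_open T \<longleftrightarrow>
     (\<forall>t\<in>T. \<forall>L. finite L \<longrightarrow> L \<subseteq> {1..} \<longrightarrow>
        openin (top_of_set (slice L t)) (T \<inter> slice L t))"

definition smooth_in_times :: "times set \<Rightarrow> (times \<Rightarrow> real) \<Rightarrow> bool" where
  "smooth_in_times T f \<longleftrightarrow>
     (\<forall>ls. set ls \<subseteq> {1..} \<longrightarrow>
        (\<forall>t\<in>T. \<forall>l\<ge>1. (\<lambda>x. foldr partial ls f (t(l := x))) field_differentiable at (t l)) \<and>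
        (\<forall>t\<in>T. \<forall>L. finite L \<longrightarrow> L \<subseteq> {1..} \<longrightarrow>
           continuous_on (T \<inter> slice L t) (foldr partial ls f)))"

section \<open>Schur polynomials and the associated differential operators\<close>

text \<open>
  Real polynomials in \<open>t\<^sub>0, t\<^sub>1, \<dots>\<close>: finitely supported maps from exponent vectors to
  coefficients, with the convolution product of \<^theory>\<open>HOL-Library.Poly_Mapping\<close>.
\<close>

type_synonym rpoly = "(nat \<Rightarrow>\<^sub>0 nat) \<Rightarrow>\<^sub>0 real"

definition pconst :: "real \<Rightarrow> rpoly" where
  "pconst c = Poly_Mapping.single 0 c"

definition pvar :: "nat \<Rightarrow> rpoly" where
  "pvar l = Poly_Mapping.single (Poly_Mapping.single l 1) 1"

text \<open>
  The generating function is a power series in \<open>z\<close> over the polynomial ring; \<^const>\<open>fps_exp\<close>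
  is not available there, as it requires a field of coefficients.
\<close>

definition schur_gf :: "rpoly fps" where
  "schur_gf = Abs_fps (\<lambda>j. pconst (1 / fact j)) oo Abs_fps (\<lambda>l. if l = 0 then 0 else pvar l)"

definition schur :: "int \<Rightarrow> rpoly" where
  "schur k = (if k < 0 then 0 else fps_nth schur_gf (nat k))"

text \<open>
  Substitution of operators \<open>A l\<close> for the variables of a polynomial. In each monomial the
  operators are composed in the order of their indices; on smooth functions the operators used
  below commute.
\<close>

definition subst_op ::
  "(nat \<Rightarrow> (times \<Rightarrow> real) \<Rightarrow> times \<Rightarrow> real) \<Rightarrow> rpoly \<Rightarrow> (times \<Rightarrow> real) \<Rightarrow> times \<Rightarrow> real" where
  "subst_op A p f t =
     (\<Sum>e\<in>Poly_Mapping.keys p. Poly_Mapping.lookup p e *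
        foldr (\<lambda>l. A l ^^ Poly_Mapping.lookup e l)
          (sorted_list_of_set (Poly_Mapping.keys e)) f t)"

text \<open>The operator obtained from \<open>s\<^sub>k\<close> by \<open>t\<^sub>l \<mapsto> -(1/l) \<partial>/\<partial>t\<^sub>l\<close>.\<close>

definition schur_op :: "int \<Rightarrow> (times \<Rightarrow> real) \<Rightarrow> times \<Rightarrow> real" where
  "schur_op k = subst_op (\<lambda>l f t. - (1 / real l) * partial l f t) (schur k)"

section \<open>Pfaffians and tau functions\<close>

text \<open>The Pfaffian of the \<open>2M \<times> 2M\<close> matrix \<open>A\<close>, with rows and columns numbered from \<open>0\<close>.\<close>

definition pfaffian :: "nat \<Rightarrow> (nat \<Rightarrow> nat \<Rightarrow> real) \<Rightarrow> real" where
  "pfaffian M A =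
     (\<Sum>p | p permutes {..<2 * M}.
        of_int (sign p) * (\<Prod>i<M. A (p (2 * i)) (p (2 * i + 1)))) / (2 ^ M * fact M)"

datatype label = Idx nat | Dlab nat

text \<open>
  The entry for two labels \<open>d\<^sub>k\<close>, \<open>d\<^sub>l\<close> is set to \<open>0\<close>. The tau functions contain at most one
  such label, so it occurs only on the diagonal.
\<close>

fun pf_entry ::
  "(nat \<Rightarrow> nat \<Rightarrow> times \<Rightarrow> real) \<Rightarrow> (nat \<Rightarrow> nat \<Rightarrow> times \<Rightarrow> real) \<Rightarrow> times \<Rightarrow> label \<Rightarrow> label \<Rightarrow> real"
where
  "pf_entry \<mu> \<beta> t (Idx i) (Idx j) = \<mu> i j t"
| "pf_entry \<mu> \<beta> t (Dlab k) (Idx i) = \<beta> k i t"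
| "pf_entry \<mu> \<beta> t (Idx i) (Dlab k) = - \<beta> k i t"
| "pf_entry \<mu> \<beta> t (Dlab k) (Dlab l) = 0"

text \<open>Meaningful only for lists of even length.\<close>

definition Pf ::
  "(nat \<Rightarrow> nat \<Rightarrow> times \<Rightarrow> real) \<Rightarrow> (nat \<Rightarrow> nat \<Rightarrow> times \<Rightarrow> real) \<Rightarrow> label list \<Rightarrow> times \<Rightarrow> real" where
  "Pf \<mu> \<beta> as t = pfaffian (length as div 2) (\<lambda>p q. pf_entry \<mu> \<beta> t (as ! p) (as ! q))"

text \<open>
  In \<open>tau_even\<close> and \<open>tau_odd\<close> the argument \<open>r\<close> is the full lower index, even respectively
  odd: \<open>tau_even \<mu> \<beta> (2n) m\<close> is \<open>\<tau>\<close> with index \<open>2n\<close>, and \<open>tau_odd \<mu> \<beta> k (2n+1) m\<close> is \<open>\<tau>\<close>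
  with index \<open>2n+1,k\<close>. The index of \<open>tau_odd\<close> is an integer because \<open>-1\<close> occurs.
\<close>

definition tau_even ::
  "(nat \<Rightarrow> nat \<Rightarrow> times \<Rightarrow> real) \<Rightarrow> (nat \<Rightarrow> nat \<Rightarrow> times \<Rightarrow> real) \<Rightarrow> nat \<Rightarrow> nat \<Rightarrow> times \<Rightarrow> real" where
  "tau_even \<mu> \<beta> r m = Pf \<mu> \<beta> (map Idx [m..<m + r])"

definition tau_odd ::
  "(nat \<Rightarrow> nat \<Rightarrow> times \<Rightarrow> real) \<Rightarrow> (nat \<Rightarrow> nat \<Rightarrow> times \<Rightarrow> real) \<Rightarrow>
     nat \<Rightarrow> int \<Rightarrow> nat \<Rightarrow> times \<Rightarrow> real" where
  "tau_odd \<mu> \<beta> k r m =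
     (if r < 0 then (\<lambda>t. 0) else Pf \<mu> \<beta> (Dlab k # map Idx [m..<m + nat r]))"

end

theory Submission
  imports Defs
begin

text \<open>
  Each \<open>\<partial>\<^sub>l\<close> acts on the labels of a Pfaffian as a derivation that shifts integer labels by \<open>l\<close>, that is, as
  multiplication by the power sum \<open>p\<^sub>l\<close> on exponent vectors. Hence \<open>exp (- \<Sum>l. z\<^sup>l \<partial>\<^sub>l / l)\<close> acts as
  \<open>\<Prod>i. (1 - z x\<^sub>i)\<close>, and the \<open>k\<close>-th Schur operator applied to a tau function is \<open>(-1)\<^sup>k\<close> times the
  Pfaffian of the labels enlarged at the top by one, with a single label removed. After this the two
  identities are four-term Pfaffian relations for a common set of labels extended by the four labels
  \<open>d\<^sub>k\<close>, \<open>m\<close>, \<open>m + \<ell>\<close> and the top label; both follow from one bilinear identity, obtained by expanding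
  Pfaffians along one row.
\<close>

text \<open>The tau functions are not closed under the derivations: raising labels of an interval
  can leave gaps. The argument therefore runs in the larger family of Pfaffians with arbitrary
  integer labels, indexed by exponent vectors. First derivatives stay in the linear span of this
  family, so all iterated derivatives follow from the first-order equations, and the order of
  differentiation disappears into a commutative polynomial ring.

  The range of \<ell> ends where two of the four distinguished labels collide: for \<ell> = 0 the
  label m + \<ell> is m, for the largest \<ell> it is the top label. At these ends each Schur
  operator shifts a whole interval, is the identity, or gives zero, and no Pfaffian relation is
  used.\<close>

unbundle no vec_syntax
unbundle fps_syntax

section \<open>Schur operators as substitutions into symmetric functions\<close>

text \<open>The coefficient map \<open>h\<close> lets one construction serve twice: with the
  identity it evaluates label functions to real numbers, with \<open>pconst\<close> it substitutes
  polynomials for variables.\<close>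

definition lin_ext :: "('c::zero \<Rightarrow> 'b::comm_ring_1) \<Rightarrow> ('k \<Rightarrow> 'b) \<Rightarrow> ('k \<Rightarrow>\<^sub>0 'c) \<Rightarrow> 'b" where
  "lin_ext h F p = (\<Sum>e\<in>Poly_Mapping.keys p. h (Poly_Mapping.lookup p e) * F e)"

lemma poly_mapping_sum_single:
  "p = (\<Sum>e\<in>Poly_Mapping.keys p. Poly_Mapping.single e (Poly_Mapping.lookup p e))"
  by (rule poly_mapping_eqI)
     (auto simp: lookup_sum lookup_single when_def in_keys_iff sum.delta)

lemma lin_ext_superset:
  assumes "h 0 = 0" "finite S" "Poly_Mapping.keys p \<subseteq> S"
  shows "lin_ext h F p = (\<Sum>e\<in>S. h (Poly_Mapping.lookup p e) * F e)"
  unfolding lin_ext_def using assms by (intro sum.mono_neutral_left) (auto simp: in_keys_iff)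

lemma lin_ext_0 [simp]: "lin_ext h F 0 = 0"
  by (simp add: lin_ext_def)

lemma lin_ext_single: "h 0 = 0 \<Longrightarrow> lin_ext h F (Poly_Mapping.single e c) = h c * F e"
  by (simp add: lin_ext_def)

lemma lin_ext_add:
  fixes h :: "'c::ab_group_add \<Rightarrow> 'b::comm_ring_1"
  assumes "Modules.additive h"
  shows "lin_ext h F (p + q) = lin_ext h F p + lin_ext h F q"
proof -
  interpret Modules.additive h by fact
  let ?S = "Poly_Mapping.keys p \<union> Poly_Mapping.keys q"
  have "Poly_Mapping.keys (p + q) \<subseteq> ?S" by (rule keys_add)
  then show ?thesis
    by (simp add: lin_ext_superset[where h = h and S = ?S, OF zero] lookup_add add distrib_right sum.distrib)
qed

lemma lin_ext_sum:
  fixes h :: "'c::ab_group_add \<Rightarrow> 'b::comm_ring_1"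
  assumes "Modules.additive h"
  shows "lin_ext h F (\<Sum>i\<in>I. p i) = (\<Sum>i\<in>I. lin_ext h F (p i))"
  by (induction I rule: infinite_finite_induct) (simp_all add: lin_ext_add assms)

lemma lin_ext_mult:
  fixes p q :: "'k::monoid_add \<Rightarrow>\<^sub>0 'c::ring"
  assumes "Modules.additive h" "\<And>a b. h (a * b) = h a * h b"
    and "\<And>e f. E (e + f) = E e * E f"
  shows "lin_ext h E (p * q) = lin_ext h E p * lin_ext h E q"
proof -
  note h0 = Modules.additive.zero[OF assms(1)]
  have "lin_ext h E (p * q) = lin_ext h E (\<Sum>e\<in>Poly_Mapping.keys p. \<Sum>f\<in>Poly_Mapping.keys q.
      Poly_Mapping.single (e + f) (Poly_Mapping.lookup p e * Poly_Mapping.lookup q f))"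
    by (subst poly_mapping_sum_single[of p], subst poly_mapping_sum_single[of q])
       (simp add: sum_product mult_single)
  also have "\<dots> = lin_ext h E p * lin_ext h E q"
    by (simp add: lin_ext_sum[OF assms(1)] lin_ext_single[of h, OF h0] assms(2,3))
       (simp add: lin_ext_def sum_product ac_simps)
  finally show ?thesis .
qed

text \<open>Here \<open>F\<close> need not be multiplicative: a monomial factor translates the
  argument of \<open>F\<close>. This is how multiplication by a variable becomes a shift of a
  label.\<close>

lemma lin_ext_single_mult:
  fixes p :: "'k::monoid_add \<Rightarrow>\<^sub>0 'c::ring"
  assumes "Modules.additive h" "\<And>a b. h (a * b) = h a * h b"
  shows "lin_ext h F (Poly_Mapping.single e c * p) = h c * lin_ext h (\<lambda>f. F (e + f)) p"
proof -
  note h0 = Modules.additive.zero[OF assms(1)]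
  have "lin_ext h F (Poly_Mapping.single e c * p) = lin_ext h F (\<Sum>f\<in>Poly_Mapping.keys p.
      Poly_Mapping.single (e + f) (c * Poly_Mapping.lookup p f))"
    by (subst poly_mapping_sum_single[of p]) (simp add: sum_distrib_left mult_single)
  also have "\<dots> = h c * lin_ext h (\<lambda>f. F (e + f)) p"
    by (simp add: lin_ext_sum[OF assms(1)] lin_ext_single[of h, OF h0] assms(2))
       (simp add: lin_ext_def sum_distrib_left ac_simps)
  finally show ?thesis .
qed

section \<open>Power sums and their substitution for the times\<close>

abbreviation monomial :: "(nat \<Rightarrow>\<^sub>0 nat) \<Rightarrow> rpoly" where
  "monomial e \<equiv> Poly_Mapping.single e 1"

text \<open>The type \<open>rpoly\<close> has two roles. In \<open>schur\<close> the variables are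
  the times; here they are \<open>x_0, ..., x_{r-1}\<close>, one for each integer label of a
  Pfaffian, and an exponent is the label itself.\<close>

definition psum :: "nat \<Rightarrow> nat \<Rightarrow> rpoly" where
  "psum r l = (\<Sum>i<r. monomial (Poly_Mapping.single i l))"

text \<open>
  The polynomial substituted for \<open>t\<^sub>l\<close>. At \<open>l = 0\<close> the junk value \<open>1 / 0 = 0\<close> makes it \<open>0\<close>, in agreement
  with the operator \<open>- (1 / real 0) * partial 0\<close>, so index \<open>0\<close> needs no separate treatment.
\<close>

definition miwa :: "nat \<Rightarrow> nat \<Rightarrow> rpoly" where
  "miwa r l = pconst (- (1 / real l)) * psum r l"

lemma additive_id: "Modules.additive (\<lambda>x::real. x)"
  by unfold_locales simp

lemma additive_pconst: "Modules.additive pconst"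
  by unfold_locales (simp add: pconst_def single_add)

lemma pconst_mult: "pconst (a * b) = pconst a * pconst b"
  by (simp add: pconst_def mult_single)

lemma pconst_1 [simp]: "pconst 1 = 1" and pconst_0 [simp]: "pconst 0 = 0"
  by (simp_all add: pconst_def)

lemma pconst_of_nat: "pconst (of_nat n) = of_nat n"
  by (simp add: pconst_def)

text \<open>The power sum adds \<open>l\<close> to one exponent at a time, exactly as the derivation
  shifts one label at a time.\<close>

lemma lin_ext_miwa:
  "lin_ext (\<lambda>x. x) F (miwa r l * p) =
    - (1 / real l) * lin_ext (\<lambda>x. x) (\<lambda>e. \<Sum>i<r. F (e + Poly_Mapping.single i l)) p"
proof -
  have "lin_ext (\<lambda>x. x) F (psum r l * q) = (\<Sum>i<r. lin_ext (\<lambda>x. x) (\<lambda>e. F (Poly_Mapping.single i l + e)) q)" for q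
    unfolding psum_def sum_distrib_right lin_ext_sum[OF additive_id]
    by (intro sum.cong refl, subst lin_ext_single_mult[OF additive_id]) auto
  also have "\<dots> q = lin_ext (\<lambda>x. x) (\<lambda>e. \<Sum>i<r. F (e + Poly_Mapping.single i l)) q" for q
    unfolding lin_ext_def by (subst sum.swap) (simp add: sum_distrib_left add.commute)
  finally have 1: "lin_ext (\<lambda>x. x) F (psum r l * q) = lin_ext (\<lambda>x. x) (\<lambda>e. \<Sum>i<r. F (e + Poly_Mapping.single i l)) q" for q .
  show ?thesis
    unfolding miwa_def pconst_def mult.assoc
    by (subst lin_ext_single_mult[OF additive_id]) (simp_all add: 1)
qed

definition miwa_subst :: "nat \<Rightarrow> rpoly \<Rightarrow> rpoly" where
  "miwa_subst r = lin_ext pconst (\<lambda>e. \<Prod>l\<in>Poly_Mapping.keys e. miwa r l ^ Poly_Mapping.lookup e l)"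

lemma monomial_subst_superset:
  assumes "finite S" "Poly_Mapping.keys e \<subseteq> S"
  shows "(\<Prod>l\<in>Poly_Mapping.keys e. c l ^ Poly_Mapping.lookup e l) = (\<Prod>l\<in>S. c l ^ Poly_Mapping.lookup e l)"
  using assms by (intro prod.mono_neutral_left) (auto simp: in_keys_iff)

lemma monomial_subst_add:
  fixes c :: "'a \<Rightarrow> 'b::comm_monoid_mult"
  shows "(\<Prod>l\<in>Poly_Mapping.keys (e + f). c l ^ Poly_Mapping.lookup (e + f) l) =
   (\<Prod>l\<in>Poly_Mapping.keys e. c l ^ Poly_Mapping.lookup e l) *
   (\<Prod>l\<in>Poly_Mapping.keys f. c l ^ Poly_Mapping.lookup f l)"
proof -
  let ?S = "Poly_Mapping.keys e \<union> Poly_Mapping.keys f"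
  have "Poly_Mapping.keys (e + f) \<subseteq> ?S" by (rule keys_add)
  then have "(\<Prod>l\<in>Poly_Mapping.keys (e + f). c l ^ Poly_Mapping.lookup (e + f) l) =
      (\<Prod>l\<in>?S. c l ^ Poly_Mapping.lookup (e + f) l)"
    by (intro monomial_subst_superset) simp
  also have "\<dots> = (\<Prod>l\<in>?S. c l ^ Poly_Mapping.lookup e l) * (\<Prod>l\<in>?S. c l ^ Poly_Mapping.lookup f l)"
    by (simp add: lookup_add power_add prod.distrib)
  also have "(\<Prod>l\<in>?S. c l ^ Poly_Mapping.lookup e l) = (\<Prod>l\<in>Poly_Mapping.keys e. c l ^ Poly_Mapping.lookup e l)"
    by (intro monomial_subst_superset[symmetric]) auto
  also have "(\<Prod>l\<in>?S. c l ^ Poly_Mapping.lookup f l) = (\<Prod>l\<in>Poly_Mapping.keys f. c l ^ Poly_Mapping.lookup f l)"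
    by (intro monomial_subst_superset[symmetric]) auto
  finally show ?thesis .
qed

lemma miwa_subst_mult: "miwa_subst r (p * q) = miwa_subst r p * miwa_subst r q"
  unfolding miwa_subst_def
  by (rule lin_ext_mult) (auto simp: additive_pconst pconst_mult monomial_subst_add)

lemma miwa_subst_sum: "miwa_subst r (\<Sum>i\<in>I. p i) = (\<Sum>i\<in>I. miwa_subst r (p i))"
  unfolding miwa_subst_def by (rule lin_ext_sum) (rule additive_pconst)

lemma miwa_subst_pconst: "miwa_subst r (pconst c) = pconst c"
  unfolding miwa_subst_def pconst_def by (subst lin_ext_single) auto

lemma miwa_subst_pvar: "miwa_subst r (pvar l) = miwa r l"
  unfolding miwa_subst_def pvar_def by (subst lin_ext_single) auto

lemma miwa_subst_of_nat: "miwa_subst r (of_nat n) = of_nat n"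
  using miwa_subst_pconst[of r "of_nat n"] by (simp add: pconst_of_nat)

section \<open>The substituted generating function as a product of linear factors\<close>

lemma fps_deriv_schur_gf:
  "fps_deriv schur_gf = schur_gf * Abs_fps (\<lambda>l. of_nat (Suc l) * pvar (Suc l))"
proof -
  let ?E = "Abs_fps (\<lambda>j. pconst (1 / fact j))"
  let ?L = "Abs_fps (\<lambda>l. if l = 0 then 0 else pvar l)"
  have "fps_deriv ?E = ?E"
  proof (rule fps_ext)
    fix j
    have "of_nat (Suc j) * pconst (1 / fact (Suc j)) = pconst (of_nat (Suc j) * (1 / fact (Suc j)))"
      by (simp only: pconst_mult pconst_of_nat)
    also have "of_nat (Suc j) * (1 / fact (Suc j)) = (1 / fact j :: real)"
      by (simp add: divide_simps del: of_nat_Suc)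
    finally show "fps_deriv ?E $ j = ?E $ j" by (simp del: of_nat_Suc fact_Suc)
  qed
  moreover have "fps_deriv ?L = Abs_fps (\<lambda>l. of_nat (Suc l) * pvar (Suc l))"
    by (rule fps_ext) (simp del: of_nat_Suc)
  ultimately show ?thesis
    unfolding schur_gf_def by (subst fps_compose_deriv) simp_all
qed

lemma schur_gf_0: "schur_gf $ 0 = 1"
  by (simp add: schur_gf_def fps_compose_def)

text \<open>Coefficient \<open>k\<close> of the equation determines coefficient \<open>Suc k\<close>
  from the earlier ones; characteristic zero allows cancelling the factor
  \<open>Suc k\<close>.\<close>

lemma fps_ode_unique:
  fixes f g :: "'a::{idom,ring_char_0} fps"
  assumes "fps_deriv f = f * m" "fps_deriv g = g * m" "f $ 0 = g $ 0"
  shows "f = g"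
proof (rule fps_ext)
  fix n show "f $ n = g $ n"
  proof (induction n rule: less_induct)
    case (less n)
    show ?case
    proof (cases n)
      case (Suc k)
      have "of_nat (Suc k) * f $ Suc k = (f * m) $ k"
        using arg_cong[OF assms(1), of "\<lambda>h. h $ k"] by (simp del: of_nat_Suc)
      also have "\<dots> = (g * m) $ k"
        unfolding fps_mult_nth using less Suc by (intro sum.cong) auto
      also have "\<dots> = of_nat (Suc k) * g $ Suc k"
        using arg_cong[OF assms(2), of "\<lambda>h. h $ k"] by (simp del: of_nat_Suc)
      finally have "of_nat (Suc k) * f $ Suc k = of_nat (Suc k) * g $ Suc k" .
      then show ?thesis unfolding Suc mult_cancel_left of_nat_eq_0_iff by simp
    qed (use assms in simp)
  qed
qed

lemma of_nat_Suc_miwa: "of_nat (Suc l) * miwa r (Suc l) = - psum r (Suc l)"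
proof -
  have "of_nat (Suc l) * miwa r (Suc l) = pconst (of_nat (Suc l) * (- (1 / real (Suc l)))) * psum r (Suc l)"
    by (simp only: miwa_def pconst_mult pconst_of_nat mult.assoc)
  also have "of_nat (Suc l) * (- (1 / real (Suc l))) = -1" by simp
  finally show ?thesis using Modules.additive.minus[OF additive_pconst, of 1] by simp
qed

abbreviation var :: "nat \<Rightarrow> rpoly" where
  "var i \<equiv> monomial (Poly_Mapping.single i 1)"

lemma var_power: "var i ^ n = monomial (Poly_Mapping.single i n)"
  by (induction n) (simp_all add: mult_single single_add[symmetric])

text \<open>The logarithmic derivative of a factor 1 - x z is minus the geometric series with
  coefficients \<open>x ^ Suc l\<close>; summing over the variables gives the negative power
  sums.\<close>

lemma fps_deriv_prod_linear:
  "fps_deriv (\<Prod>i<r. 1 - fps_const (var i) * fps_X) =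
    (\<Prod>i<r. 1 - fps_const (var i) * fps_X) * Abs_fps (\<lambda>l. - psum r (Suc l))"
proof (induction r)
  case 0
  show ?case by (rule fps_ext) (simp add: psum_def)
next
  case (Suc r)
  let ?Q = "\<Prod>i<r. 1 - fps_const (var i) * fps_X"
  let ?m = "Abs_fps (\<lambda>l. - (var r ^ Suc l))"
  have d: "fps_deriv (1 - fps_const (var r) * fps_X) = - fps_const (var r)"
    by simp
  have m: "(1 - fps_const (var r) * fps_X) * ?m = - fps_const (var r)"
  proof (rule fps_ext)
    fix n show "((1 - fps_const (var r) * fps_X) * ?m) $ n = (- fps_const (var r)) $ n"
      by (cases n) (simp_all add: algebra_simps)
  qed
  have s: "Abs_fps (\<lambda>l. - psum (Suc r) (Suc l)) = Abs_fps (\<lambda>l. - psum r (Suc l)) + ?m"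
    by (rule fps_ext) (simp add: psum_def var_power del: power_Suc One_nat_def)
  have "fps_deriv (\<Prod>i<Suc r. 1 - fps_const (var i) * fps_X) =
      ?Q * (1 - fps_const (var r) * fps_X) * Abs_fps (\<lambda>l. - psum r (Suc l)) + ?Q * (- fps_const (var r))"
    unfolding prod.lessThan_Suc fps_deriv_mult d Suc.IH by (simp only: ac_simps)
  also have "\<dots> = ?Q * (1 - fps_const (var r) * fps_X) * Abs_fps (\<lambda>l. - psum (Suc r) (Suc l))"
    unfolding m[symmetric] s by (simp add: algebra_simps)
  finally show ?case by simp
qed

text \<open>The substitution respects sums and products, so it can be applied coefficientwise to the
  differential equation of \<open>schur_gf\<close>. The result is the linear equation of the
  product, and both constant terms are 1; composition of power series never has to be carried
  through the substitution.\<close>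

lemma miwa_subst_schur_gf: "Abs_fps (\<lambda>k. miwa_subst r (schur_gf $ k)) = (\<Prod>i<r. 1 - fps_const (var i) * fps_X)"
proof (rule fps_ode_unique[OF _ fps_deriv_prod_linear])
  show "fps_deriv (Abs_fps (\<lambda>k. miwa_subst r (schur_gf $ k))) = Abs_fps (\<lambda>k. miwa_subst r (schur_gf $ k)) * Abs_fps (\<lambda>l. - psum r (Suc l))"
  proof (rule fps_ext)
    fix k
    have "of_nat (Suc k) * miwa_subst r (schur_gf $ Suc k) = miwa_subst r (fps_deriv schur_gf $ k)"
      by (simp add: miwa_subst_mult miwa_subst_of_nat del: of_nat_Suc)
    also have "\<dots> = (\<Sum>i=0..k. miwa_subst r (schur_gf $ i) * (- psum r (Suc (k - i))))"
      unfolding fps_deriv_schur_gf fps_mult_nth miwa_subst_sum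
      by (simp only: miwa_subst_mult miwa_subst_of_nat miwa_subst_pvar of_nat_Suc_miwa fps_nth_Abs_fps)
    finally show "fps_deriv (Abs_fps (\<lambda>k. miwa_subst r (schur_gf $ k))) $ k =
       (Abs_fps (\<lambda>k. miwa_subst r (schur_gf $ k)) * Abs_fps (\<lambda>l. - psum r (Suc l))) $ k"
      by (simp add: fps_mult_nth del: of_nat_Suc)
  qed
  have "(\<Prod>i<r. 1 - fps_const (var i) * fps_X) $ 0 = 1"
    by (induction r) simp_all
  then show "Abs_fps (\<lambda>k. miwa_subst r (schur_gf $ k)) $ 0 = (\<Prod>i<r. 1 - fps_const (var i) * fps_X) $ 0"
    using miwa_subst_pconst[of r 1] by (simp add: schur_gf_0)
qed

lemma prod_var: "finite S \<Longrightarrow> (\<Prod>i\<in>S. var i) = monomial (\<Sum>i\<in>S. Poly_Mapping.single i 1)"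
  by (induction S rule: finite_induct) (simp_all add: mult_single)

text \<open>Choosing the linear term from the factors in \<open>S\<close> and 1 from the others
  contributes in degree \<open>card S\<close> only. The sum is the elementary symmetric polynomial
  up to sign.\<close>

lemma miwa_subst_schur:
  "miwa_subst r (schur (int k)) = (\<Sum>S | S \<subseteq> {..<r} \<and> card S = k.
     pconst ((-1) ^ k) * monomial (\<Sum>i\<in>S. Poly_Mapping.single i 1))"
proof -
  have prod1: "(\<Prod>i\<in>S. - fps_const (var i) * fps_X) =
      fps_const (pconst ((-1) ^ card S) * monomial (\<Sum>i\<in>S. Poly_Mapping.single i 1)) * fps_X ^ card S"
    if "S \<subseteq> {..<r}" for S
  proof -
    have fin: "finite S" using that finite_subset by blast
    have p: "(\<Prod>i\<in>S. fps_const (f i)) = fps_const (\<Prod>i\<in>S. f i)" for f :: "nat \<Rightarrow> rpoly"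
      using fin by (induction S rule: finite_induct) (simp_all flip: fps_const_mult)
    have m: "pconst ((-1) ^ n) = (-1) ^ n" for n
      by (induction n) (simp_all add: Modules.additive.minus[OF additive_pconst])
    have "(\<Prod>i\<in>S. - fps_const (var i) * fps_X) = fps_const (\<Prod>i\<in>S. - var i) * fps_X ^ card S"
      by (simp add: prod.distrib p)
    then show ?thesis
      by (simp only: prod_uminus prod_var[OF fin] m)
  qed
  have "miwa_subst r (schur (int k)) = (\<Prod>i<r. 1 - fps_const (var i) * fps_X) $ k"
    using arg_cong[OF miwa_subst_schur_gf, of "\<lambda>h. h $ k"] by (simp add: schur_def)
  also have "\<dots> = (\<Prod>i<r. - fps_const (var i) * fps_X + 1) $ k"
    by (simp only: mult_minus_left uminus_add_conv_diff)
  also have "\<dots> = (\<Sum>S\<in>Pow {..<r}. \<Prod>i\<in>S. - fps_const (var i) * fps_X) $ k"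
    by (subst prod_add) simp_all
  also have "\<dots> = (\<Sum>S\<in>Pow {..<r}. if card S = k then
      pconst ((-1) ^ k) * monomial (\<Sum>i\<in>S. Poly_Mapping.single i 1) else 0)"
    unfolding fps_sum_nth by (intro sum.cong refl, subst prod1) auto
  also have "\<dots> = (\<Sum>S\<in>{S \<in> Pow {..<r}. card S = k}. pconst ((-1) ^ k) * monomial (\<Sum>i\<in>S. Poly_Mapping.single i 1))"
    by (rule sum.inter_filter[symmetric]) simp
  also have "{S \<in> Pow {..<r}. card S = k} = {S. S \<subseteq> {..<r} \<and> card S = k}" by auto
  finally show ?thesis .
qed

text \<open>A function known only on \<open>T\<close> can be replaced by its formula before
  differentiating, because \<open>T\<close> contains a neighbourhood of \<open>t\<close> on each
  coordinate line.\<close>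

lemma eventually_in_times:
  assumes "finitely_open T" "t \<in> T" "l \<ge> 1"
  shows "eventually (\<lambda>x. t(l := x) \<in> T) (nhds (t l))"
proof -
  have "openin (top_of_set (slice {l} t)) (T \<inter> slice {l} t)"
    using assms unfolding finitely_open_def by auto
  then obtain U where U: "open U" "T \<inter> slice {l} t = slice {l} t \<inter> U"
    by (auto simp: openin_open)
  have "continuous_on UNIV (\<lambda>x. t(l := x))"
  proof (rule continuous_on_coordinatewise_then_product)
    show "continuous_on UNIV (\<lambda>x. (t(l := x)) i)" for i
      by (cases "i = l") simp_all
  qed
  then have "open ((\<lambda>x. t(l := x)) -` U)"
    using U(1) by (simp add: continuous_on_open_vimage)
  moreover have "t l \<in> (\<lambda>x. t(l := x)) -` U"
    using assms(2) U(2) by (auto simp: slice_def)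
  moreover have "t(l := x) \<in> T" if "x \<in> (\<lambda>x. t(l := x)) -` U" for x
    using U(2) that by (auto simp: slice_def)
  ultimately show ?thesis
    unfolding eventually_nhds by blast
qed

text \<open>
  Linear extension of \<open>F\<close> to polynomials turns \<open>- (1 / l) \<partial>\<^sub>l\<close> into multiplication by \<open>miwa r l\<close>, hence
  \<open>s\<^sub>k\<close> into multiplication by \<open>(-1)\<^sup>k\<close> times the elementary symmetric polynomial of degree \<open>k\<close>.
\<close>

lemma schur_op_eq_elementary:
  fixes F :: "(nat \<Rightarrow>\<^sub>0 nat) \<Rightarrow> times \<Rightarrow> real"
  assumes T: "finitely_open T"
    and F: "\<And>e l t. t \<in> T \<Longrightarrow> l \<ge> 1 \<Longrightarrow> ((\<lambda>x. F e (t(l := x))) has_field_derivative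
        (\<Sum>i<r. F (e + Poly_Mapping.single i l) t)) (at (t l))"
    and t: "t \<in> T"
  shows "schur_op (int k) (F e) t = (-1) ^ k *
    (\<Sum>S | S \<subseteq> {..<r} \<and> card S = k. F (e + (\<Sum>i\<in>S. Poly_Mapping.single i 1)) t)"
proof -
  define L where "L p t = lin_ext (\<lambda>x. x) (\<lambda>e. F e t) p" for p t
  define A where "A l f t = - (1 / real l) * partial l f t" for l f t
  \<comment> \<open>The representation of \<open>f\<close> is assumed on all of \<open>T\<close>,
    not just at \<open>t\<close>: the next derivative needs it at nearby points. For the same reason
    the inductions below generalise over \<open>t\<close>.\<close>
  have step: "A l f t = L (miwa r l * p) t" if f: "\<And>t. t \<in> T \<Longrightarrow> f t = L p t" and t: "t \<in> T" for l f p t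
  proof (cases "l = 0")
    case False
    have "((\<lambda>x. L p (t(l := x))) has_field_derivative
        lin_ext (\<lambda>x. x) (\<lambda>e. \<Sum>i<r. F (e + Poly_Mapping.single i l) t) p) (at (t l))"
      unfolding L_def lin_ext_def using False
      by (intro DERIV_sum DERIV_cmult F[OF t]) simp
    moreover have "eventually (\<lambda>x. f (t(l := x)) = L p (t(l := x))) (nhds (t l))"
      using eventually_in_times[OF T t, of l] False by (auto elim!: eventually_mono simp: f)
    ultimately have "((\<lambda>x. f (t(l := x))) has_field_derivative
        lin_ext (\<lambda>x. x) (\<lambda>e. \<Sum>i<r. F (e + Poly_Mapping.single i l) t) p) (at (t l))"
      by (subst DERIV_cong_ev[OF refl _ refl])
    then have "partial l f t = lin_ext (\<lambda>x. x) (\<lambda>e. \<Sum>i<r. F (e + Poly_Mapping.single i l) t) p"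
      unfolding partial_def by (rule DERIV_imp_deriv)
    then show ?thesis by (simp add: A_def L_def lin_ext_miwa)
  qed (simp add: A_def L_def miwa_def)
  have pow: "(A l ^^ n) f t = L (miwa r l ^ n * p) t"
    if "\<And>t. t \<in> T \<Longrightarrow> f t = L p t" "t \<in> T" for l n f p t
    using that(2)
  proof (induction n arbitrary: t)
    case (Suc n)
    show ?case using step[OF Suc.IH Suc.prems] by (simp add: mult.assoc)
  qed (use that in simp)
  have fold: "foldr (\<lambda>l. A l ^^ g l) ls f t = L ((\<Prod>l\<leftarrow>ls. miwa r l ^ g l) * p) t"
    if "\<And>t. t \<in> T \<Longrightarrow> f t = L p t" "t \<in> T" for g ls f p t
    using that(2)
  proof (induction ls arbitrary: t)
    case (Cons l ls)
    show ?case using pow[OF Cons.IH Cons.prems] by (simp add: mult.assoc)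
  qed (use that in simp)
  have subst: "subst_op A q f t = L (miwa_subst r q * p) t"
    if f: "\<And>t. t \<in> T \<Longrightarrow> f t = L p t" and t: "t \<in> T" for q f p t
  proof -
    have "subst_op A q f t = (\<Sum>e\<in>Poly_Mapping.keys q. Poly_Mapping.lookup q e *
        L ((\<Prod>l\<in>Poly_Mapping.keys e. miwa r l ^ Poly_Mapping.lookup e l) * p) t)"
      unfolding subst_op_def
      by (intro sum.cong refl, subst fold[OF f t]) (simp_all add: prod.distinct_set_conv_list[symmetric])
    also have "\<dots> = L (miwa_subst r q * p) t"
      unfolding miwa_subst_def lin_ext_def[of pconst] L_def sum_distrib_right lin_ext_sum[OF additive_id]
      by (intro sum.cong refl, simp only: mult.assoc pconst_def, subst lin_ext_single_mult[OF additive_id]) simp_all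
    finally show ?thesis .
  qed
  have "schur_op (int k) (F e) t = subst_op A (schur (int k)) (F e) t"
    unfolding schur_op_def A_def ..
  \<comment> \<open>The function \<open>F e\<close> is represented by the polynomial
    \<open>monomial e\<close>, and a factor \<open>x_i\<close> then raises entry \<open>i\<close> of
    \<open>e\<close> by one.\<close>
  also have "\<dots> = L (miwa_subst r (schur (int k)) * monomial e) t"
    by (rule subst[OF _ t]) (simp add: L_def lin_ext_single)
  also have "\<dots> = (\<Sum>S | S \<subseteq> {..<r} \<and> card S = k. (-1) ^ k * F (e + (\<Sum>i\<in>S. Poly_Mapping.single i 1)) t)"
    unfolding miwa_subst_schur L_def sum_distrib_right lin_ext_sum[OF additive_id]
    by (intro sum.cong refl) (simp add: pconst_def mult_single lin_ext_single add.commute)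
  finally show ?thesis by (simp add: sum_distrib_left)
qed

section \<open>Pfaffians\<close>

abbreviation transp :: "nat \<Rightarrow> nat \<Rightarrow> nat \<Rightarrow> nat" where
  "transp \<equiv> Transposition.transpose"


text \<open>A permutation never pairs a position with itself. Leaving out the diagonal matters when
  a row and the matching column are changed separately, as in the derivative of a Pfaffian, since
  the two changes disagree where they cross.\<close>

lemma pfaffian_cong:
  assumes "\<And>p q. p < 2 * M \<Longrightarrow> q < 2 * M \<Longrightarrow> p \<noteq> q \<Longrightarrow> A p q = B p q"
  shows "pfaffian M A = pfaffian M B"
proof -
  have "A (p (2 * i)) (p (2 * i + 1)) = B (p (2 * i)) (p (2 * i + 1))"
    if p: "p permutes {..<2 * M}" and "i < M" for p i
  proof (rule assms)
    show "p (2 * i) < 2 * M" "p (2 * i + 1) < 2 * M"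
      using permutes_in_image[OF p, of "2 * i"] permutes_in_image[OF p, of "2 * i + 1"] that(2)
      by simp_all
    show "p (2 * i) \<noteq> p (2 * i + 1)"
      using inj_eq[OF permutes_inj[OF p]] by simp
  qed
  then show ?thesis
    unfolding pfaffian_def by (intro arg_cong2[of _ _ _ _ "(/)"] sum.cong refl) simp
qed

lemma pfaffian_permute:
  assumes "\<pi> permutes {..<2 * M}"
  shows "pfaffian M (\<lambda>p q. A (\<pi> p) (\<pi> q)) = of_int (sign \<pi>) * pfaffian M A"
proof -
  have "(\<Sum>p | p permutes {..<2 * M}. of_int (sign p) * (\<Prod>i<M. A (p (2 * i)) (p (2 * i + 1)))) =
    (\<Sum>p | p permutes {..<2 * M}. of_int (sign (\<pi> \<circ> p)) * (\<Prod>i<M. A ((\<pi> \<circ> p) (2 * i)) ((\<pi> \<circ> p) (2 * i + 1))))"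
    using setum_permutations_compose_left[OF assms] .
  also have "\<dots> = of_int (sign \<pi>) * (\<Sum>p | p permutes {..<2 * M}. of_int (sign p) *
      (\<Prod>i<M. A (\<pi> (p (2 * i))) (\<pi> (p (2 * i + 1)))))"
    unfolding sum_distrib_left
    by (intro sum.cong refl)
       (simp add: sign_compose[OF permutes_imp_permutation[OF _ assms] permutes_imp_permutation[of "{..<2 * M}"]])
  finally have "of_int (sign \<pi>) * (\<Sum>p | p permutes {..<2 * M}. of_int (sign p) * (\<Prod>i<M. A (p (2 * i)) (p (2 * i + 1)))) =
     (of_int (sign \<pi>) * of_int (sign \<pi>)) * (\<Sum>p | p permutes {..<2 * M}. of_int (sign p) *
      (\<Prod>i<M. A (\<pi> (p (2 * i))) (\<pi> (p (2 * i + 1)))))"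
    by (simp add: mult.assoc)
  also have "(of_int (sign \<pi>) * of_int (sign \<pi>) :: real) = 1"
    by (simp flip: of_int_mult)
  finally show ?thesis by (simp add: pfaffian_def)
qed

text \<open>Exchanging two equal labels changes nothing except the sign.\<close>

lemma pfaffian_repeated:
  assumes "i < 2 * M" "j < 2 * M" "i \<noteq> j" "a i = a j"
  shows "pfaffian M (\<lambda>p q. A (a p) (a q)) = 0"
proof -
  have eq: "a (transp i j p) = a p" for p
    using assms(4) by (simp add: Transposition.transpose_def)
  have "pfaffian M (\<lambda>p q. A (a p) (a q)) = - pfaffian M (\<lambda>p q. A (a p) (a q))"
    using pfaffian_permute[of "transp i j" M "\<lambda>p q. A (a p) (a q)"] permutes_swap_id[of i "{..<2 * M}" j] assms(1-3)
    by (simp add: sign_swap_id eq)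
  then show ?thesis by simp
qed

text \<open>
  Swapping the two entries of a pair, or two pairs, does not change the term of a permutation. So each of
  the \<open>2 M + 2\<close> positions of the last index contributes equally, which absorbs the change of normalisation.
  Moving row \<open>c\<close> to the end by a transposition instead of deleting it keeps the signs free of \<open>c\<close>.
\<close>

lemma pfaffian_expand_last:
  assumes skew: "\<And>p q. A q p = - A p q"
  shows "pfaffian (Suc M) A = (\<Sum>c<2 * M + 1. (if c = 2 * M then 1 else -1) * A c (2 * M + 1) *
     pfaffian M (\<lambda>p q. A (transp (2 * M) c p) (transp (2 * M) c q)))"
proof -
  define z where "z = 2 * M + 1"
  let ?S = "{..<2 * Suc M}"
  define f where "f p = of_int (sign p) * (\<Prod>i<Suc M. A (p (2 * i)) (p (2 * i + 1)))" for p
  have perm: "permutation p" if "p permutes ?S" for p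
    using that permutes_imp_permutation[of ?S p] by simp
  \<comment> \<open>The sign of the transposition cancels against the skew symmetry of the
    entry.\<close>
  have swap_in: "f (p \<circ> transp (2 * i) (2 * i + 1)) = f p" if "p permutes ?S" "i < Suc M" for p i
  proof -
    let ?T = "transp (2 * i) (2 * i + 1)"
    have T: "?T (2 * j) = (if j = i then 2 * i + 1 else 2 * j)"
      "?T (2 * j + 1) = (if j = i then 2 * i else 2 * j + 1)" for j
      by (auto simp: Transposition.transpose_def) (presburger+)?
    have "(\<Prod>j<Suc M. A (p (?T (2 * j))) (p (?T (2 * j + 1)))) =
        (\<Prod>j<Suc M. (if j = i then -1 else 1) * A (p (2 * j)) (p (2 * j + 1)))"
    proof (intro prod.cong refl)
      show "A (p (?T (2 * j))) (p (?T (2 * j + 1))) = (if j = i then -1 else 1) * A (p (2 * j)) (p (2 * j + 1))" for j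
        unfolding T using skew[of "p (2 * i)" "p (2 * i + 1)"] by auto
    qed
    also have "\<dots> = - (\<Prod>j<Suc M. A (p (2 * j)) (p (2 * j + 1)))"
      using that(2) by (simp add: prod.distrib prod.delta del: prod.lessThan_Suc)
    finally show ?thesis
      unfolding f_def using sign_compose[OF perm[OF that(1)] permutation_swap_id, of "2 * i" "2 * i + 1"]
      by (simp add: sign_swap_id del: prod.lessThan_Suc)
  qed
  \<comment> \<open>Two transpositions have sign 1, and the factors of the product are merely
    permuted.\<close>
  have swap_out: "f (p \<circ> (transp (2 * i) (2 * j) \<circ> transp (2 * i + 1) (2 * j + 1))) = f p"
    if "p permutes ?S" "i < Suc M" "j < Suc M" for p i j
  proof -
    let ?T = "transp (2 * i) (2 * j) \<circ> transp (2 * i + 1) (2 * j + 1)"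
    have T: "?T (2 * k) = 2 * transp i j k" "?T (2 * k + 1) = 2 * transp i j k + 1" for k
      by (auto simp: Transposition.transpose_def) (presburger+)?
    have "(\<Prod>k<Suc M. A (p (?T (2 * k))) (p (?T (2 * k + 1)))) =
       (\<Prod>k<Suc M. A (p (2 * k)) (p (2 * k + 1)))"
      unfolding T using that
      by (subst (2) prod.permute[of "transp i j"]) (auto intro: permutes_swap_id simp: o_def)
    moreover have "sign ?T = 1"
      by (subst sign_compose) (auto simp: permutation_swap_id sign_swap_id)
    moreover have "permutation ?T"
      by (intro permutation_compose permutation_swap_id)
    ultimately show ?thesis
      unfolding f_def using sign_compose[OF perm[OF that(1)], of ?T] by (simp add: o_def)
  qed
  have move: "(\<Sum>p | p permutes ?S. if p u = z then f p else 0) = (\<Sum>p | p permutes ?S. if p z = z then f p else 0)"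
    if u: "u < 2 * Suc M" for u
  proof -
    define i where "i = u div 2"
    have i: "i < Suc M" using u by (auto simp: i_def)
    \<comment> \<open>This exchanges the pair containing \<open>u\<close> with the last pair. It
      sends an odd \<open>u\<close> to \<open>z\<close>; for even \<open>u\<close> the swap inside
      the pair must act first.\<close>
    define \<tau> where "\<tau> = transp (2 * i) (2 * M) \<circ> transp (2 * i + 1) (2 * M + 1)"
    have \<tau>: "\<tau> permutes ?S" "f (p \<circ> \<tau>) = f p" if "p permutes ?S" for p
      unfolding \<tau>_def using i that
      using swap_out[OF that i, of M] by (auto intro!: permutes_compose permutes_swap_id)
    have "\<exists>\<sigma>. \<sigma> permutes ?S \<and> \<sigma> u = z \<and> (\<forall>p. p permutes ?S \<longrightarrow> f (p \<circ> \<sigma>) = f p)"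
    proof (cases "even u")
      case False
      then have "u = 2 * i + 1" by (simp add: i_def)
      then have "\<tau> u = z" by (auto simp: \<tau>_def z_def Transposition.transpose_def)
      then show ?thesis using \<tau> permutes_id by blast
    next
      case True
      then have u: "u = 2 * i" by (simp add: i_def)
      let ?T = "transp (2 * i) (2 * i + 1)"
      have T: "?T permutes ?S" using i by (intro permutes_swap_id) auto
      have "f (p \<circ> (\<tau> \<circ> ?T)) = f p" if "p permutes ?S" for p
        using swap_in[OF permutes_compose[OF \<tau>(1) that] i] \<tau>(2)[OF that] that permutes_id
        by (simp add: o_assoc)
      moreover have "(\<tau> \<circ> ?T) u = z" by (auto simp: u \<tau>_def z_def Transposition.transpose_def)
      moreover have "\<tau> \<circ> ?T permutes ?S" by (intro permutes_compose T \<tau>(1)[OF permutes_id])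
      ultimately show ?thesis by blast
    qed
    then obtain \<sigma> where \<sigma>: "\<sigma> permutes ?S" "\<sigma> u = z" "\<And>p. p permutes ?S \<Longrightarrow> f (p \<circ> \<sigma>) = f p"
      by blast
    show ?thesis
      by (subst sum_permutations_compose_right[OF \<sigma>(1)]) (auto intro!: sum.cong simp: \<sigma>(2,3))
  qed
  have "(\<Sum>p | p permutes ?S. f p) = (\<Sum>p | p permutes ?S. \<Sum>u\<in>?S. if p u = z then f p else 0)"
  proof (intro sum.cong refl)
    fix p assume "p \<in> {p. p permutes ?S}"
    then have p: "p permutes ?S" by simp
    have "p u = z \<longleftrightarrow> u = inv p z" for u
      using permutes_inv_eq[OF p, of z u] by auto
    then have "(\<Sum>u\<in>?S. if p u = z then f p else 0) = (\<Sum>u\<in>?S. if u = inv p z then f p else 0)"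
      by simp
    also have "\<dots> = f p"
      using permutes_in_image[OF permutes_inv[OF p], of z] by (simp add: z_def)
    finally show "f p = (\<Sum>u\<in>?S. if p u = z then f p else 0)" ..
  qed
  also have "\<dots> = (\<Sum>u\<in>?S. \<Sum>p | p permutes ?S. if p z = z then f p else 0)"
    by (subst sum.swap, intro sum.cong refl move) simp
  also have "\<dots> = (2 * real M + 2) * (\<Sum>p | p permutes ?S. if p z = z then f p else 0)"
    by (simp only: sum_constant card_lessThan) simp
  also have "(\<Sum>p | p permutes ?S. if p z = z then f p else 0) = (\<Sum>p | p permutes ?S \<and> p z = z. f p)"
    using sum.inter_filter[of "{p. p permutes ?S}" f "\<lambda>p. p z = z"] by (simp add: finite_permutations)
  also have "{p. p permutes ?S \<and> p z = z} = {p. p permutes insert (2 * M) {..<2 * M}}"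
  proof (intro Collect_cong iffI conjI)
    fix p assume p: "p permutes ?S \<and> p z = z"
    show "p permutes insert (2 * M) {..<2 * M}"
    proof (rule permutes_superset)
      show "p permutes ?S" using p by simp
      fix x assume "x \<in> ?S - insert (2 * M) {..<2 * M}"
      then have "x = z" by (auto simp: z_def)
      then show "p x = x" using p by metis
    qed
  next
    fix p assume p: "p permutes insert (2 * M) {..<2 * M}"
    show "p permutes ?S" by (rule permutes_subset[OF p]) auto
    show "p z = z" by (rule permutes_not_in[OF p]) (auto simp: z_def)
  qed
  \<comment> \<open>The index \<open>c\<close> is \<open>p (2 * M)\<close>, the partner of the last
    row; what remains of \<open>p\<close> is a permutation of the first \<open>2 * M\<close>
    positions.\<close>
  also have "(\<Sum>p | p permutes insert (2 * M) {..<2 * M}. f p) =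
     (\<Sum>c\<in>insert (2 * M) {..<2 * M}. \<Sum>q | q permutes {..<2 * M}. f (transp (2 * M) c \<circ> q))"
    by (rule sum_over_permutations_insert) auto
  also have "\<dots> = (\<Sum>c\<in>insert (2 * M) {..<2 * M}. (if c = 2 * M then 1 else -1) * A c (2 * M + 1) *
     (pfaffian M (\<lambda>p q. A (transp (2 * M) c p) (transp (2 * M) c q)) * (2 ^ M * fact M)))"
  proof (intro sum.cong refl)
    fix c assume c: "c \<in> insert (2 * M) {..<2 * M}"
    let ?T = "transp (2 * M) c"
    have "f (?T \<circ> q) = (if c = 2 * M then 1 else -1) * A c (2 * M + 1) *
        (of_int (sign q) * (\<Prod>i<M. A (?T (q (2 * i))) (?T (q (2 * i + 1)))))"
      if q: "q permutes {..<2 * M}" for q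
    proof -
      have "permutation q" using permutes_imp_permutation[OF _ q] by simp
      then have "sign (?T \<circ> q) = (if c = 2 * M then 1 else -1) * sign q"
        by (simp add: sign_compose permutation_swap_id sign_swap_id)
      moreover have "q (2 * M) = 2 * M" "q (2 * M + 1) = 2 * M + 1"
        using permutes_not_in[OF q] by auto
      moreover have "?T (2 * M + 1) = 2 * M + 1" using c by (auto simp: Transposition.transpose_def)
      ultimately show ?thesis unfolding f_def by simp
    qed
    then show "(\<Sum>q | q permutes {..<2 * M}. f (?T \<circ> q)) = (if c = 2 * M then 1 else -1) * A c (2 * M + 1) *
       (pfaffian M (\<lambda>p q. A (?T p) (?T q)) * (2 ^ M * fact M))"
      unfolding pfaffian_def by (simp add: sum_distrib_left)
  qed
  also have "insert (2 * M) {..<2 * M} = {..<2 * M + 1}" by auto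
  finally have "(\<Sum>p | p permutes ?S. f p) = (2 * real M + 2) * (2 ^ M * fact M) *
     (\<Sum>c<2 * M + 1. (if c = 2 * M then 1 else -1) * A c (2 * M + 1) *
      pfaffian M (\<lambda>p q. A (transp (2 * M) c p) (transp (2 * M) c q)))" (is "_ = _ * ?R")
    unfolding sum_distrib_left by (simp only: ac_simps)
  moreover have "(2::real) ^ Suc M * fact (Suc M) = (2 * real M + 2) * (2 ^ M * fact M)"
    by (simp add: algebra_simps)
  moreover have "(2 * real M + 2) * (2 ^ M * fact M) \<noteq> 0"
    by (simp add: add_nonneg_eq_0_iff)
  ultimately show ?thesis
    unfolding pfaffian_def[of "Suc M"] f_def[symmetric] by (simp only: nonzero_mult_div_cancel_left not_False_eq_True)
qed

section \<open>Pfaffians of label lists and their relations\<close>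

definition pfl :: "('x \<Rightarrow> 'x \<Rightarrow> real) \<Rightarrow> 'x list \<Rightarrow> real" where
  "pfl A as = pfaffian (length as div 2) (\<lambda>p q. A (as ! p) (as ! q))"

text \<open>The labelling \<open>a\<close> is free beyond position \<open>2 * M\<close>, so that the
  updated and transposed sequences of the bilinear identity can be read as lists.\<close>

lemma pfl_eq:
  assumes "length as = 2 * M" "\<And>p. p < 2 * M \<Longrightarrow> a p = as ! p"
  shows "pfaffian M (\<lambda>p q. A (a p) (a q)) = pfl A as"
  unfolding pfl_def using assms by (auto intro!: pfaffian_cong)

lemma pfl_repeated:
  assumes "even (length as)" "\<not> distinct as"
  shows "pfl A as = 0"
proof -
  obtain i j where "i < length as" "j < length as" "i \<noteq> j" "as ! i = as ! j"
    using assms(2) by (auto simp: distinct_conv_nth)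
  then show ?thesis
    unfolding pfl_def using assms(1) by (intro pfaffian_repeated[of i _ j]) auto
qed

lemma pfl_swap:
  assumes "even (length xs + length zs)"
  shows "pfl A (xs @ x # y # zs) = - pfl A (xs @ y # x # zs)"
proof -
  let ?n = "length xs" let ?as = "xs @ y # x # zs"
  let ?M = "length ?as div 2"
  have M: "2 * ?M = length ?as" using assms by simp
  have "pfl A (xs @ x # y # zs) = pfaffian ?M (\<lambda>p q. A (?as ! transp ?n (Suc ?n) p) (?as ! transp ?n (Suc ?n) q))"
    by (rule pfl_eq[symmetric])
       (use M in \<open>auto simp: nth_append nth_Cons' Transposition.transpose_def\<close>)
  also have "\<dots> = - pfl A ?as"
    unfolding pfl_def
    by (subst pfaffian_permute) (use M in \<open>auto intro!: permutes_swap_id simp: sign_swap_id\<close>)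
  finally show ?thesis .
qed

lemma pfl_move:
  assumes "odd (length xs + length ys + length zs)"
  shows "pfl A (xs @ x # ys @ zs) = (-1) ^ length ys * pfl A (xs @ ys @ x # zs)"
  using assms
proof (induction ys arbitrary: xs)
  case (Cons y ys)
  have "pfl A (xs @ x # y # ys @ zs) = - pfl A ((xs @ [y]) @ x # ys @ zs)"
    using Cons.prems by (subst pfl_swap) auto
  also have "\<dots> = - ((-1) ^ length ys * pfl A ((xs @ [y]) @ ys @ x # zs))"
    using Cons.prems by (subst Cons.IH) auto
  finally show ?case by simp
qed simp

text \<open>
  Expanding the longer Pfaffian along its last index turns both sides into the same double sum over
  \<open>A (a c) (b d)\<close>, up to the sign from skew symmetry.
\<close>

lemma pfaffian_bilinear:
  assumes skew: "\<And>x y. A y x = - A x y"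
  defines "pf \<equiv> \<lambda>M a. pfaffian M (\<lambda>p q. A (a p) (a q))"
  defines "\<epsilon> \<equiv> \<lambda>c d. if c = d then 1 else -1 :: real"
  shows "(\<Sum>d<2 * N + 1. \<epsilon> d (2 * N) * pf (Suc M) (a(2 * M + 1 := b d)) * pf N (b \<circ> transp (2 * N) d)) =
    - (\<Sum>c<2 * M + 1. \<epsilon> c (2 * M) * pf (Suc N) (b(2 * N + 1 := a c)) * pf M (a \<circ> transp (2 * M) c))"
proof -
  have ex: "pf (Suc M) (a(2 * M + 1 := x)) = (\<Sum>c<2 * M + 1. \<epsilon> c (2 * M) * A (a c) x * pf M (a \<circ> transp (2 * M) c))"
    for M a x
  proof -
    \<comment> \<open>Transposing \<open>2 * M\<close> with some \<open>c\<close> below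
      \<open>2 * M + 1\<close> never reaches position \<open>2 * M + 1\<close>, so the smaller
      Pfaffians do not see the label \<open>x\<close> placed there.\<close>
    have *: "(a(2 * M + 1 := x)) (transp (2 * M) c p) = a (transp (2 * M) c p)" if "c < 2 * M + 1" "p < 2 * M" for p c
      using that by (auto simp: Transposition.transpose_def)
    have "pfaffian M (\<lambda>p q. A ((a(2 * M + 1 := x)) (transp (2 * M) c p)) ((a(2 * M + 1 := x)) (transp (2 * M) c q)))
       = pfaffian M (\<lambda>p q. A (a (transp (2 * M) c p)) (a (transp (2 * M) c q)))" if "c < 2 * M + 1" for c
      by (intro pfaffian_cong) (simp only: *[OF that])
    note cong = this
    show ?thesis
      unfolding pf_def \<epsilon>_def
    proof (subst pfaffian_expand_last, rule skew, intro sum.cong refl)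
      fix c assume "c \<in> {..<2 * M + 1}"
      then have c: "c < 2 * M + 1" by simp
      then show "(if c = 2 * M then 1 else - 1) * A ((a(2 * M + 1 := x)) c) ((a(2 * M + 1 := x)) (2 * M + 1)) *
          pfaffian M (\<lambda>p q. A ((a(2 * M + 1 := x)) (transp (2 * M) c p)) ((a(2 * M + 1 := x)) (transp (2 * M) c q))) =
        (if c = 2 * M then 1 else - 1) * A (a c) x *
          pfaffian M (\<lambda>p q. A ((a \<circ> transp (2 * M) c) p) ((a \<circ> transp (2 * M) c) q))"
        unfolding cong[OF c] by simp
    qed
  qed
  have "(\<Sum>d<2 * N + 1. \<epsilon> d (2 * N) * pf (Suc M) (a(2 * M + 1 := b d)) * pf N (b \<circ> transp (2 * N) d)) =
    (\<Sum>d<2 * N + 1. \<Sum>c<2 * M + 1. \<epsilon> d (2 * N) * \<epsilon> c (2 * M) * A (a c) (b d) *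
       pf M (a \<circ> transp (2 * M) c) * pf N (b \<circ> transp (2 * N) d))"
    unfolding ex sum_distrib_left sum_distrib_right by (simp only: ac_simps)
  also have "\<dots> = (\<Sum>c<2 * M + 1. \<Sum>d<2 * N + 1. - (\<epsilon> d (2 * N) * \<epsilon> c (2 * M) * A (b d) (a c) *
       pf M (a \<circ> transp (2 * M) c) * pf N (b \<circ> transp (2 * N) d)))"
    by (subst sum.swap, subst skew) simp
  also have "\<dots> = - (\<Sum>c<2 * M + 1. \<epsilon> c (2 * M) * pf (Suc N) (b(2 * N + 1 := a c)) * pf M (a \<circ> transp (2 * M) c))"
    unfolding ex sum_distrib_left sum_distrib_right sum_negf by (simp only: ac_simps)
  finally show ?thesis .
qed

text \<open>
  The bilinear identity for the sequences \<open>W\<close> and \<open>W, x, y, u, v\<close>, respectively \<open>W, x\<close> and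
  \<open>W, y, u, v\<close> in the even case: all other terms contain a repeated label.
\<close>

lemma pfl_relation_odd:
  assumes skew: "\<And>x y. A y x = - A x y" and W: "odd (length W)"
  shows "pfl A (W @ [v]) * pfl A (W @ [x, y, u]) =
    pfl A (W @ [x]) * pfl A (W @ [v, y, u]) + pfl A (W @ [y]) * pfl A (W @ [x, v, u])
    + pfl A (W @ [u]) * pfl A (W @ [x, y, v])"
proof -
  obtain M where M: "length W = 2 * M + 1" using W by (rule oddE)
  let ?b = "\<lambda>p. (W @ [x, y, u, v]) ! p"
  define f where "f d = pfaffian (Suc M) (\<lambda>p q. A ((((!) W)(2 * M + 1 := ?b d)) p) ((((!) W)(2 * M + 1 := ?b d)) q))" for d
  define g where "g d = pfaffian (M + 2) (\<lambda>p q. A ((?b \<circ> transp (2 * (M + 2)) d) p) ((?b \<circ> transp (2 * (M + 2)) d) q))" for d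
  have zero: "pfaffian (Suc (M + 2)) (\<lambda>p q. A ((?b(2 * (M + 2) + 1 := W ! c)) p) ((?b(2 * (M + 2) + 1 := W ! c)) q)) = 0"
    if "c < 2 * M + 1" for c
    using that by (intro pfaffian_repeated[of c _ "2 * (M + 2) + 1"]) (auto simp: M nth_append)
  have "(\<Sum>d<2 * (M + 2) + 1. (if d = 2 * (M + 2) then 1 else -1) * f d * g d) =
    - (\<Sum>c<2 * M + 1. (if c = 2 * M then 1 else -1) *
        pfaffian (Suc (M + 2)) (\<lambda>p q. A ((?b(2 * (M + 2) + 1 := W ! c)) p) ((?b(2 * (M + 2) + 1 := W ! c)) q)) *
        pfaffian M (\<lambda>p q. A (((!) W \<circ> transp (2 * M) c) p) (((!) W \<circ> transp (2 * M) c) q)))"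
    unfolding f_def g_def
    by (rule pfaffian_bilinear[where A = A and M = M and N = "M + 2" and a = "(!) W" and b = ?b, OF skew])
  also have "\<dots> = 0"
    by (intro neg_equal_0_iff_equal[THEN iffD2] sum.neutral ballI) (simp only: zero lessThan_iff mult_zero_left mult_zero_right)
  finally have "(\<Sum>d<2 * (M + 2) + 1. (if d = 2 * (M + 2) then 1 else -1) * f d * g d) = 0" .
  also have "2 * (M + 2) + 1 = Suc (Suc (Suc (Suc (2 * M + 1))))" by simp
  finally have *: "(\<Sum>d<2 * M + 1. (if d = 2 * (M + 2) then 1 else -1) * f d * g d)
     - f (2 * M + 1) * g (2 * M + 1) - f (2 * M + 2) * g (2 * M + 2) - f (2 * M + 3) * g (2 * M + 3)
     + f (2 * M + 4) * g (2 * M + 4) = 0"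
    unfolding sum.lessThan_Suc[of _ "2 * M + 1"] sum.lessThan_Suc[of _ "Suc (2 * M + 1)"]
      sum.lessThan_Suc[of _ "Suc (Suc (2 * M + 1))"] sum.lessThan_Suc[of _ "Suc (Suc (Suc (2 * M + 1)))"]
    by (simp add: numeral_eq_Suc)
  have "f d = 0" if "d < 2 * M + 1" for d
    unfolding f_def using that by (intro pfaffian_repeated[of d _ "2 * M + 1"]) (auto simp: M nth_append)
  then have "(\<Sum>d<2 * M + 1. (if d = 2 * (M + 2) then 1 else -1) * f d * g d) = 0"
    by (intro sum.neutral) simp
  moreover have f: "f d = pfl A (W @ [?b d])" for d
    unfolding f_def by (intro pfl_eq) (auto simp: M nth_append)
  have "?b (2 * M + 1) = x" "?b (2 * M + 2) = y" "?b (2 * M + 3) = u" "?b (2 * M + 4) = v"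
    by (simp_all add: nth_append M nth_Cons')
  then have "f (2 * M + 1) = pfl A (W @ [x])" "f (2 * M + 2) = pfl A (W @ [y])"
    "f (2 * M + 3) = pfl A (W @ [u])" "f (2 * M + 4) = pfl A (W @ [v])"
    unfolding f by simp_all
  \<comment> \<open>Position \<open>2 * (M + 2)\<close> holds \<open>v\<close>; the transposition
    puts \<open>v\<close> in the place of the removed label, which explains the order in these
    lists.\<close>
  moreover have "g (2 * M + 1) = pfl A (W @ [v, y, u])" "g (2 * M + 2) = pfl A (W @ [x, v, u])"
    "g (2 * M + 3) = pfl A (W @ [x, y, v])" "g (2 * M + 4) = pfl A (W @ [x, y, u])"
    unfolding g_def by (intro pfl_eq; auto simp: M nth_append nth_Cons' Transposition.transpose_def)+
  ultimately show ?thesis using * by simp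
qed

lemma pfl_relation_even:
  assumes skew: "\<And>x y. A y x = - A x y" and W: "even (length W)"
  shows "pfl A (W @ [x, v]) * pfl A (W @ [y, u]) + pfl A W * pfl A (W @ [y, u, v, x]) =
    pfl A (W @ [x, y]) * pfl A (W @ [v, u]) + pfl A (W @ [x, u]) * pfl A (W @ [y, v])"
proof -
  obtain M where M: "length W = 2 * M" using W by (auto elim: evenE)
  let ?a = "\<lambda>p. (W @ [x]) ! p"
  let ?b = "\<lambda>p. (W @ [y, u, v]) ! p"
  define f where "f d = pfaffian (Suc M) (\<lambda>p q. A ((?a(2 * M + 1 := ?b d)) p) ((?a(2 * M + 1 := ?b d)) q))" for d
  define g where "g d = pfaffian (M + 1) (\<lambda>p q. A ((?b \<circ> transp (2 * (M + 1)) d) p) ((?b \<circ> transp (2 * (M + 1)) d) q))" for d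
  define f' where "f' d = pfaffian (Suc (M + 1)) (\<lambda>p q. A ((?b(2 * (M + 1) + 1 := ?a d)) p) ((?b(2 * (M + 1) + 1 := ?a d)) q))" for d
  define g' where "g' d = pfaffian M (\<lambda>p q. A ((?a \<circ> transp (2 * M) d) p) ((?a \<circ> transp (2 * M) d) q))" for d
  have "(\<Sum>d<2 * (M + 1) + 1. (if d = 2 * (M + 1) then 1 else -1) * f d * g d) =
     - (\<Sum>d<2 * M + 1. (if d = 2 * M then 1 else -1) * f' d * g' d)"
    unfolding f_def g_def f'_def g'_def by (rule pfaffian_bilinear[of A, OF skew])
  also have "2 * (M + 1) + 1 = Suc (Suc (Suc (2 * M)))" by simp
  finally have *: "(\<Sum>d<2 * M. (if d = 2 * (M + 1) then 1 else -1) * f d * g d)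
     - f (2 * M) * g (2 * M) - f (2 * M + 1) * g (2 * M + 1) + f (2 * M + 2) * g (2 * M + 2)
     = - (\<Sum>d<2 * M. (if d = 2 * M then 1 else -1) * f' d * g' d) - f' (2 * M) * g' (2 * M)"
    unfolding sum.lessThan_Suc[of _ "2 * M"] sum.lessThan_Suc[of _ "Suc (2 * M)"]
      sum.lessThan_Suc[of _ "Suc (Suc (2 * M))"]
    by (simp add: numeral_eq_Suc)
  have "f d = 0" if "d < 2 * M" for d
    unfolding f_def using that by (intro pfaffian_repeated[of d _ "2 * M + 1"]) (auto simp: M nth_append)
  then have "(\<Sum>d<2 * M. (if d = 2 * (M + 1) then 1 else -1) * f d * g d) = 0"
    by (intro sum.neutral) simp
  moreover have "f' d = 0" if "d < 2 * M" for d
    unfolding f'_def using that by (intro pfaffian_repeated[of d _ "2 * (M + 1) + 1"]) (auto simp: M nth_append)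
  then have "(\<Sum>d<2 * M. (if d = 2 * M then 1 else -1) * f' d * g' d) = 0"
    by (intro sum.neutral) simp
  moreover have f: "f d = pfl A (W @ [x, ?b d])" for d
    unfolding f_def by (intro pfl_eq) (auto simp: M nth_append nth_Cons')
  have "?b (2 * M) = y" "?b (2 * M + 1) = u" "?b (2 * M + 2) = v"
    by (simp_all add: nth_append M nth_Cons')
  then have "f (2 * M) = pfl A (W @ [x, y])" "f (2 * M + 1) = pfl A (W @ [x, u])" "f (2 * M + 2) = pfl A (W @ [x, v])"
    unfolding f by simp_all
  moreover have "g (2 * M) = pfl A (W @ [v, u])" "g (2 * M + 1) = pfl A (W @ [y, v])"
    "g (2 * M + 2) = pfl A (W @ [y, u])"
    unfolding g_def by (intro pfl_eq; auto simp: M nth_append nth_Cons' Transposition.transpose_def)+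
  \<comment> \<open>In contrast to the odd case one term survives on this side: \<open>x\<close>
    does not come from \<open>W\<close>, so appending it to \<open>W, y, u, v\<close> need not
    repeat a label.\<close>
  moreover have "f' (2 * M) = pfl A (W @ [y, u, v, x])"
    unfolding f'_def by (intro pfl_eq) (auto simp: M nth_append nth_Cons')
  moreover have "g' (2 * M) = pfl A W"
    unfolding g'_def by (intro pfl_eq) (auto simp: M nth_append)
  ultimately show ?thesis using * by (simp add: algebra_simps)
qed

section \<open>Derivatives of Pfaffians\<close>

lemma has_field_derivative_prod_sum:
  fixes f :: "'i \<Rightarrow> real \<Rightarrow> real"
  assumes "\<And>i. i \<in> I \<Longrightarrow> (f i has_field_derivative f' i) (at x)"
  shows "((\<lambda>x. \<Prod>i\<in>I. f i x) has_field_derivative (\<Sum>i\<in>I. \<Prod>j\<in>I. if j = i then f' j else f j x)) (at x)"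
  using assms
proof (induction I rule: infinite_finite_induct)
  case (insert a I)
  have "((\<lambda>x. f a x * (\<Prod>i\<in>I. f i x)) has_field_derivative
      f' a * (\<Prod>i\<in>I. f i x) + (\<Sum>i\<in>I. \<Prod>j\<in>I. if j = i then f' j else f j x) * f a x) (at x)"
    using insert by (intro DERIV_mult) auto
  moreover have "(\<Prod>j\<in>I. if j = a then f' j else f j x) = (\<Prod>i\<in>I. f i x)"
    using insert.hyps by (intro prod.cong) auto
  moreover have "(\<Sum>i\<in>I. \<Prod>j\<in>insert a I. if j = i then f' j else f j x) =
     (\<Sum>i\<in>I. \<Prod>j\<in>I. if j = i then f' j else f j x) * f a x"
    unfolding sum_distrib_right using insert.hyps
    by (intro sum.cong refl) (auto simp: mult.commute)
  ultimately show ?case using insert.hyps by simp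
qed simp_all

lemma sum_pairs: "(\<Sum>r<2 * M. h r) = (\<Sum>i<M. h (2 * i) + h (2 * i + 1 :: nat))" for h :: "nat \<Rightarrow> 'a::comm_monoid_add"
  by (induction M) (simp_all add: add.assoc)

text \<open>In each term every index occurs in exactly one entry, as its first or its second
  argument. Splitting the derivative of an entry into a part \<open>D\<close> for the first argument
  and a part \<open>D'\<close> for the second turns the product rule into a sum over single
  indices.\<close>

lemma pfaffian_has_field_derivative:
  fixes E :: "real \<Rightarrow> nat \<Rightarrow> nat \<Rightarrow> real"
  assumes E: "\<And>p q. p < 2 * M \<Longrightarrow> q < 2 * M \<Longrightarrow> ((\<lambda>x. E x p q) has_field_derivative D p q + D' p q) (at x)"
  shows "((\<lambda>x. pfaffian M (E x)) has_field_derivative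
    (\<Sum>r<2 * M. pfaffian M (\<lambda>p q. if p = r then D p q else if q = r then D' p q else E x p q))) (at x)"
proof -
  let ?G = "\<lambda>r p q. if p = r then D p q else if q = r then D' p q else E x p q"
  have *: "(\<Sum>i<M. \<Prod>j<M. if j = i then D (p (2 * j)) (p (2 * j + 1)) + D' (p (2 * j)) (p (2 * j + 1))
      else E x (p (2 * j)) (p (2 * j + 1))) = (\<Sum>r<2 * M. \<Prod>j<M. ?G r (p (2 * j)) (p (2 * j + 1)))"
    if p: "p permutes {..<2 * M}" for p
  proof -
    have inj: "p a = p b \<longleftrightarrow> a = b" for a b using permutes_inj[OF p] by (auto dest: injD)
    \<comment> \<open>Renumbering by \<open>p\<close> makes the two indices of each entry adjacent,
      so that they can be summed in pairs.\<close>
    have "(\<Sum>r<2 * M. \<Prod>j<M. ?G r (p (2 * j)) (p (2 * j + 1))) =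
        (\<Sum>r<2 * M. \<Prod>j<M. ?G (p r) (p (2 * j)) (p (2 * j + 1)))"
      by (subst sum.permute[OF p]) (simp add: o_def)
    also have "\<dots> = (\<Sum>i<M. (\<Prod>j<M. ?G (p (2 * i)) (p (2 * j)) (p (2 * j + 1))) +
        (\<Prod>j<M. ?G (p (2 * i + 1)) (p (2 * j)) (p (2 * j + 1))))"
      by (rule sum_pairs)
    also have "\<dots> = (\<Sum>i<M. \<Prod>j<M. if j = i then D (p (2 * j)) (p (2 * j + 1)) + D' (p (2 * j)) (p (2 * j + 1))
      else E x (p (2 * j)) (p (2 * j + 1)))"
    proof (intro sum.cong refl)
      fix i assume i: "i \<in> {..<M}"
      have split: "(\<Prod>j<M. f j) = f i * (\<Prod>j\<in>{..<M} - {i}. f j)" for f :: "nat \<Rightarrow> real"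
        using i by (intro prod.remove) auto
      have ne: "2 * j \<noteq> Suc (2 * i)" "Suc (2 * j) \<noteq> 2 * i" for j i :: nat by presburger+
      have "(\<Prod>j\<in>{..<M} - {i}. ?G (p (2 * i)) (p (2 * j)) (p (2 * j + 1))) = (\<Prod>j\<in>{..<M} - {i}. E x (p (2 * j)) (p (2 * j + 1)))"
        "(\<Prod>j\<in>{..<M} - {i}. ?G (p (2 * i + 1)) (p (2 * j)) (p (2 * j + 1))) = (\<Prod>j\<in>{..<M} - {i}. E x (p (2 * j)) (p (2 * j + 1)))"
        "(\<Prod>j\<in>{..<M} - {i}. if j = i then D (p (2 * j)) (p (2 * j + 1)) + D' (p (2 * j)) (p (2 * j + 1))
      else E x (p (2 * j)) (p (2 * j + 1))) = (\<Prod>j\<in>{..<M} - {i}. E x (p (2 * j)) (p (2 * j + 1)))"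
        by (intro prod.cong refl; auto simp: inj ne)+
      then show "(\<Prod>j<M. ?G (p (2 * i)) (p (2 * j)) (p (2 * j + 1))) +
        (\<Prod>j<M. ?G (p (2 * i + 1)) (p (2 * j)) (p (2 * j + 1))) =
        (\<Prod>j<M. if j = i then D (p (2 * j)) (p (2 * j + 1)) + D' (p (2 * j)) (p (2 * j + 1))
      else E x (p (2 * j)) (p (2 * j + 1)))"
        unfolding split by (simp add: inj ne distrib_right)
    qed
    finally show ?thesis ..
  qed
  have "((\<lambda>x. pfaffian M (E x)) has_field_derivative (\<Sum>p | p permutes {..<2 * M}. of_int (sign p) *
     (\<Sum>i<M. \<Prod>j<M. if j = i then D (p (2 * j)) (p (2 * j + 1)) + D' (p (2 * j)) (p (2 * j + 1))
      else E x (p (2 * j)) (p (2 * j + 1)))) / (2 ^ M * fact M)) (at x)"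
    unfolding pfaffian_def
  proof (intro DERIV_cdivide DERIV_sum DERIV_cmult has_field_derivative_prod_sum E)
    fix p i assume p: "p \<in> {p. p permutes {..<2 * M}}" and i: "i \<in> {..<M}"
    then show "p (2 * i) < 2 * M" "p (2 * i + 1) < 2 * M"
      using permutes_in_image[of p "{..<2 * M}" "2 * i"] permutes_in_image[of p "{..<2 * M}" "2 * i + 1"] by auto
  qed
  also have "(\<Sum>p | p permutes {..<2 * M}. of_int (sign p) *
     (\<Sum>i<M. \<Prod>j<M. if j = i then D (p (2 * j)) (p (2 * j + 1)) + D' (p (2 * j)) (p (2 * j + 1))
      else E x (p (2 * j)) (p (2 * j + 1)))) / (2 ^ M * fact M) = (\<Sum>r<2 * M. pfaffian M (?G r))"
    unfolding pfaffian_def sum_divide_distrib[symmetric]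
    by (subst sum.swap, unfold sum_distrib_left[symmetric]) (simp add: *)
  finally show ?thesis .
qed

section \<open>The Schur operators on tau functions\<close>

text \<open>Every term contains an entry involving \<open>r\<close>. This removes the contributions
  of the labels \<open>Dlab k\<close>, which the derivations do not shift.\<close>

lemma pfaffian_zero_row:
  assumes "r < 2 * M" "\<And>q. A r q = 0" "\<And>q. A q r = 0"
  shows "pfaffian M A = 0"
proof -
  have "(\<Prod>i<M. A (p (2 * i)) (p (2 * i + 1))) = 0" if p: "p permutes {..<2 * M}" for p
  proof -
    define u where "u = inv p r"
    have u: "u < 2 * M" "p u = r"
      using permutes_in_image[OF permutes_inv[OF p], of r] permutes_inverses(1)[OF p, of r] assms(1)
      by (auto simp: u_def)
    have "u = 2 * (u div 2) \<or> u = 2 * (u div 2) + 1" by presburger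
    then have "A (p (2 * (u div 2))) (p (2 * (u div 2) + 1)) = 0"
      using u(2) assms(2,3) by metis
    moreover have "u div 2 < M" using u(1) by simp
    ultimately show ?thesis by (intro prod_zero) auto
  qed
  then show ?thesis unfolding pfaffian_def by (simp del: prod_zero_iff)
qed

lemma sum_lessThan_add: "(\<Sum>r<n + m. h r) = (\<Sum>r<n. h r) + (\<Sum>i<m. h (n + i :: nat))"
  for h :: "nat \<Rightarrow> 'a::comm_monoid_add"
  by (induction m) (simp_all add: add.assoc)

text \<open>The derivation property passes from the entries to the Pfaffian. Reading the labels off
  \<open>e\<close> makes a shift the addition of \<open>Poly_Mapping.single i l\<close>, the form
  required by \<open>schur_op_eq_elementary\<close>.\<close>

lemma Pf_has_field_derivative:
  fixes \<mu> \<beta> :: "nat \<Rightarrow> nat \<Rightarrow> times \<Rightarrow> real" and Ds :: "label list"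
  assumes \<mu>: "\<And>i j. ((\<lambda>x. \<mu> i j (t(l := x))) has_field_derivative \<mu> (i + l) j t + \<mu> i (j + l) t) (at (t l))"
    and \<beta>: "\<And>k j. Dlab k \<in> set Ds \<Longrightarrow> ((\<lambda>x. \<beta> k j (t(l := x))) has_field_derivative \<beta> k (j + l) t) (at (t l))"
    and Ds: "set Ds \<subseteq> range Dlab" "even (length Ds + r)"
  shows "((\<lambda>x. Pf \<mu> \<beta> (Ds @ map (\<lambda>i. Idx (Poly_Mapping.lookup e i)) [0..<r]) (t(l := x))) has_field_derivative
    (\<Sum>i<r. Pf \<mu> \<beta> (Ds @ map (\<lambda>j. Idx (Poly_Mapping.lookup (e + Poly_Mapping.single i l) j)) [0..<r]) t)) (at (t l))"
proof -
  let ?as = "Ds @ map (\<lambda>i. Idx (Poly_Mapping.lookup e i)) [0..<r]"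
  let ?n = "length Ds"
  define M where "M = length ?as div 2"
  have M: "2 * M = ?n + r" using Ds(2) by (simp add: M_def)
  define D where "D a b = (case a of Idx i \<Rightarrow> pf_entry \<mu> \<beta> t (Idx (i + l)) b | Dlab k \<Rightarrow> 0)" for a b
  define D' where "D' a b = (case b of Idx i \<Rightarrow> pf_entry \<mu> \<beta> t a (Idx (i + l)) | Dlab k \<Rightarrow> 0)" for a b
  have as: "?as ! p = (if p < ?n then Ds ! p else Idx (Poly_Mapping.lookup e (p - ?n)))" if "p < ?n + r" for p
    using that by (auto simp: nth_append)
  have der: "((\<lambda>x. pf_entry \<mu> \<beta> (t(l := x)) a b) has_field_derivative D a b + D' a b) (at (t l))"
    if "a \<in> set ?as" "b \<in> set ?as" for a b
  proof (cases a; cases b)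
    fix k i assume "a = Dlab k" "b = Idx i"
    moreover from this have "Dlab k \<in> set Ds" using that by auto
    ultimately show ?thesis using \<beta>[of k i] by (simp add: D_def D'_def)
  next
    fix k i assume "a = Idx i" "b = Dlab k"
    moreover from this have "Dlab k \<in> set Ds" using that by auto
    ultimately show ?thesis using DERIV_minus[OF \<beta>[of k i]] by (simp add: D_def D'_def)
  qed (use \<mu> in \<open>simp_all add: D_def D'_def\<close>)
  let ?G = "\<lambda>r p q. if p = r then D (?as ! p) (?as ! q) else if q = r then D' (?as ! p) (?as ! q)
     else pf_entry \<mu> \<beta> t (?as ! p) (?as ! q)"
  have "((\<lambda>x. pfaffian M (\<lambda>p q. pf_entry \<mu> \<beta> (t(l := x)) (?as ! p) (?as ! q))) has_field_derivative
      (\<Sum>r<2 * M. pfaffian M (?G r))) (at (t l))"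
    using pfaffian_has_field_derivative[of M "\<lambda>x p q. pf_entry \<mu> \<beta> (t(l := x)) (?as ! p) (?as ! q)"
        "\<lambda>p q. D (?as ! p) (?as ! q)" "\<lambda>p q. D' (?as ! p) (?as ! q)" "t l"] der M
    unfolding fun_upd_triv by (simp del: set_append set_map)
  also have "(\<Sum>r<2 * M. pfaffian M (?G r)) = (\<Sum>i<r. pfaffian M (?G (?n + i)))"
  proof -
    have "pfaffian M (?G p) = 0" if p: "p < ?n" for p
    proof (rule pfaffian_zero_row)
      have "Ds ! p \<in> range Dlab" using Ds(1) p nth_mem by blast
      then obtain k where k: "?as ! p = Dlab k" using p by (auto simp: nth_append)
      show "p < 2 * M" using p M by simp
      show "?G p p q = 0" "?G p q p = 0" for q
        unfolding k by (simp_all add: D_def D'_def k)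
    qed
    then show ?thesis unfolding M sum_lessThan_add by simp
  qed
  also have "\<dots> = (\<Sum>i<r. Pf \<mu> \<beta> (Ds @ map (\<lambda>j. Idx (Poly_Mapping.lookup (e + Poly_Mapping.single i l) j)) [0..<r]) t)"
  proof (intro sum.cong refl)
    fix i assume "i \<in> {..<r}"
    then have i: "i < r" by simp
    let ?bs = "Ds @ map (\<lambda>j. Idx (Poly_Mapping.lookup (e + Poly_Mapping.single i l) j)) [0..<r]"
    have bs: "?bs ! p = (if p = ?n + i then Idx (Poly_Mapping.lookup e i + l) else ?as ! p)" if "p < 2 * M" for p
      using that M by (auto simp: nth_append lookup_add lookup_single when_def)
    have ai: "?as ! (?n + i) = Idx (Poly_Mapping.lookup e i)" using i by (simp add: nth_append)
    have "length ?bs div 2 = M" using M by simp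
    moreover have "pfaffian M (?G (?n + i)) = pfaffian M (\<lambda>p q. pf_entry \<mu> \<beta> t (?bs ! p) (?bs ! q))"
    proof (rule pfaffian_cong)
      fix p q assume "p < 2 * M" "q < 2 * M" "p \<noteq> q"
      then show "?G (?n + i) p q = pf_entry \<mu> \<beta> t (?bs ! p) (?bs ! q)"
        unfolding bs[OF \<open>p < 2 * M\<close>] bs[OF \<open>q < 2 * M\<close>] using ai by (auto simp: D_def D'_def)
    qed
    ultimately show "pfaffian M (?G (?n + i)) = Pf \<mu> \<beta> ?bs t"
      unfolding Pf_def by (simp only:)
  qed
  finally show ?thesis unfolding Pf_def M_def .
qed

text \<open>Starting from the minimum of \<open>S\<close>, closure under successors fills everything
  below \<open>r\<close>.\<close>

lemma upward_closed_eq_interval: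
  fixes S :: "nat set"
  assumes "S \<subseteq> {..<r}" "\<And>i. i \<in> S \<Longrightarrow> Suc i < r \<Longrightarrow> Suc i \<in> S"
  shows "S = {r - card S..<r}"
proof (cases "S = {}")
  case False
  have fin: "finite S" using assms(1) finite_subset by blast
  define a where "a = Min S"
  have a: "a \<in> S" using fin False by (simp add: a_def)
  have "i \<in> S" if "a \<le> i" "i < r" for i
    using that by (induction i rule: dec_induct) (auto intro: assms(2) a)
  moreover have "a \<le> i" "i < r" if "i \<in> S" for i
    using that fin assms(1) by (auto simp: a_def)
  ultimately have S: "S = {a..<r}" by auto
  moreover have "a < r" using a assms(1) by auto
  ultimately have "r - card S = a" by simp
  then show ?thesis using S by simp
qed simp

definition upt_gap :: "nat \<Rightarrow> nat \<Rightarrow> nat \<Rightarrow> nat list" where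
  "upt_gap m j n = [m..<j] @ [Suc j..<n]"

text \<open>
  Raising the consecutive labels at the positions in \<open>S\<close> produces a repeated label unless \<open>S\<close> consists
  of the last \<open>k\<close> positions, so a single term of the elementary symmetric polynomial survives.
\<close>

lemma schur_op_Pf:
  fixes \<mu> \<beta> :: "nat \<Rightarrow> nat \<Rightarrow> times \<Rightarrow> real" and Ds :: "label list"
  assumes T: "finitely_open T"
    and \<mu>: "\<And>i j l t. t \<in> T \<Longrightarrow> l \<ge> 1 \<Longrightarrow>
      ((\<lambda>x. \<mu> i j (t(l := x))) has_field_derivative \<mu> (i + l) j t + \<mu> i (j + l) t) (at (t l))"
    and \<beta>: "\<And>k j l t. Dlab k \<in> set Ds \<Longrightarrow> t \<in> T \<Longrightarrow> l \<ge> 1 \<Longrightarrow>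
      ((\<lambda>x. \<beta> k j (t(l := x))) has_field_derivative \<beta> k (j + l) t) (at (t l))"
    and Ds: "set Ds \<subseteq> range Dlab" "even (length Ds + r)"
    and t: "t \<in> T"
  shows "schur_op (int k) (Pf \<mu> \<beta> (Ds @ map Idx [m..<m + r])) t =
    (if k \<le> r then (-1) ^ k * Pf \<mu> \<beta> (Ds @ map Idx (upt_gap m (m + r - k) (Suc (m + r)))) t else 0)"
proof -
  define F where "F e = Pf \<mu> \<beta> (Ds @ map (\<lambda>i. Idx (Poly_Mapping.lookup e i)) [0..<r])" for e
  define e where "e = (\<Sum>i<r. Poly_Mapping.single i (m + i))"
  have e: "Poly_Mapping.lookup e i = m + i" if "i < r" for i
    using that by (simp add: e_def lookup_sum lookup_single when_def)
  have one: "Poly_Mapping.lookup (\<Sum>i\<in>S. Poly_Mapping.single i (1::nat)) j = (if j \<in> S then 1 else 0)" if "finite S" for S j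
    using that by (simp add: lookup_sum lookup_single when_def)
  have shift: "Poly_Mapping.lookup (e + (\<Sum>i\<in>S. Poly_Mapping.single i 1)) i = m + i + (if i \<in> S then 1 else 0)"
    if "i < r" "S \<subseteq> {..<r}" for S i
    using e[OF that(1)] one[OF finite_subset[OF that(2)], of i] by (simp add: lookup_add)
  have "Pf \<mu> \<beta> (Ds @ map Idx [m..<m + r]) = F e"
    unfolding F_def by (intro arg_cong[where f = "Pf \<mu> \<beta>"] arg_cong2[of _ _ _ _ "(@)"] refl nth_equalityI) (auto simp: e)
  then have "schur_op (int k) (Pf \<mu> \<beta> (Ds @ map Idx [m..<m + r])) t = schur_op (int k) (F e) t"
    by simp
  also have "\<dots> = (-1) ^ k *
    (\<Sum>S | S \<subseteq> {..<r} \<and> card S = k. F (e + (\<Sum>i\<in>S. Poly_Mapping.single i 1)) t)"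
    unfolding F_def
    by (rule schur_op_eq_elementary[OF T _ t]) (intro Pf_has_field_derivative \<mu> \<beta> Ds; simp)
  also have "(\<Sum>S | S \<subseteq> {..<r} \<and> card S = k. F (e + (\<Sum>i\<in>S. Poly_Mapping.single i 1)) t) =
      (if k \<le> r then Pf \<mu> \<beta> (Ds @ map Idx (upt_gap m (m + r - k) (Suc (m + r)))) t else 0)"
  proof (cases "k \<le> r")
    case True
    let ?S = "{r - k..<r}"
    have "F (e + (\<Sum>i\<in>S. Poly_Mapping.single i 1)) t = 0"
      if S: "S \<subseteq> {..<r}" "card S = k" "S \<noteq> ?S" for S
    proof -
      \<comment> \<open>Raising the label \<open>m + i\<close> but not its successor makes two
        neighbouring labels equal.\<close>
      obtain i where i: "i \<in> S" "Suc i < r" "Suc i \<notin> S"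
        using upward_closed_eq_interval[OF S(1)] S(2,3) by blast
      let ?as = "Ds @ map (\<lambda>j. Idx (Poly_Mapping.lookup (e + (\<Sum>i\<in>S. Poly_Mapping.single i 1)) j)) [0..<r]"
      have "?as ! (length Ds + i) = ?as ! (length Ds + Suc i)"
        using i shift[OF _ S(1), of i] shift[OF _ S(1), of "Suc i"] by (simp add: nth_append)
      moreover have "length Ds + Suc i < length ?as" using i(2) by simp
      ultimately have "\<not> distinct ?as"
        using nth_eq_iff_index_eq[of ?as "length Ds + i" "length Ds + Suc i"] by auto
      then show ?thesis
        using pfl_repeated[of ?as] Ds(2) by (simp add: F_def Pf_def pfl_def)
    qed
    then have "(\<Sum>S | S \<subseteq> {..<r} \<and> card S = k. F (e + (\<Sum>i\<in>S. Poly_Mapping.single i 1)) t) =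
        (\<Sum>S\<in>{?S}. F (e + (\<Sum>i\<in>S. Poly_Mapping.single i 1)) t)"
      using True by (intro sum.mono_neutral_right) (auto intro: finite_subset[of _ "Pow {..<r}"])
    also have "\<dots> = Pf \<mu> \<beta> (Ds @ map Idx (upt_gap m (m + r - k) (Suc (m + r)))) t"
    proof -
      have "map (\<lambda>j. Idx (Poly_Mapping.lookup (e + (\<Sum>i\<in>?S. Poly_Mapping.single i 1)) j)) [0..<r] =
         map Idx (upt_gap m (m + r - k) (Suc (m + r)))"
      proof (rule nth_equalityI)
        have S: "?S \<subseteq> {..<r}" by auto
        fix i assume "i < length (map (\<lambda>j. Idx (Poly_Mapping.lookup (e + (\<Sum>i\<in>?S. Poly_Mapping.single i 1)) j)) [0..<r])"
        then have i: "i < r" by simp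
        then show "map (\<lambda>j. Idx (Poly_Mapping.lookup (e + (\<Sum>i\<in>?S. Poly_Mapping.single i 1)) j)) [0..<r] ! i =
           map Idx (upt_gap m (m + r - k) (Suc (m + r))) ! i"
          using shift[OF i S] True by (auto simp: upt_gap_def nth_append simp del: upt_Suc)
      qed (use True in \<open>auto simp: upt_gap_def simp del: upt_Suc\<close>)
      then show ?thesis by (simp add: F_def)
    qed
    finally show ?thesis using True by simp
  next
    case False
    have "card S \<le> r" if "S \<subseteq> {..<r}" for S
      using card_mono[OF _ that] by simp
    then have "{S. S \<subseteq> {..<r} \<and> card S = k} = {}" using False by auto
    then show ?thesis using False by (simp only: sum.empty if_False)
  qed
  finally show ?thesis by simp
qed

text \<open>This serves the convention that the tau function of index -1 is zero. The zero function
  falls under the general formula with \<open>F\<close> identically zero.\<close>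

lemma schur_op_zero:
  assumes "finitely_open T" "t \<in> T"
  shows "schur_op k (\<lambda>t. 0) t = 0"
proof (cases "k < 0")
  case False
  then have "schur_op k (\<lambda>t. 0) t = schur_op (int (nat k)) (\<lambda>t. 0) t" by simp
  also have "\<dots> = 0"
    using schur_op_eq_elementary[OF assms(1), of "\<lambda>e t. 0" 0 t "nat k" 0] assms(2) by simp
  finally show ?thesis .
qed (simp add: schur_op_def subst_op_def schur_def)

lemma schur_op_neg: "k < 0 \<Longrightarrow> schur_op k f t = 0"
  by (simp add: schur_op_def subst_op_def schur_def)

section \<open>The gap relations\<close>

text \<open>Here \<open>d\<close> stands for the extra label, \<open>a\<close> for m,
  \<open>c\<close> for m + \<ell> and \<open>b\<close> for the top label; \<open>V\<close> and
  \<open>W\<close> are the intervals separated by \<open>c\<close>. All special labels are moved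
  behind \<open>V @ W\<close>. Exactly one factor of each product contains \<open>c\<close>, so
  moving it across \<open>W\<close> costs every product the same sign \<open>s\<close>.\<close>

lemma pfl_gap_relation_odd:
  assumes skew: "\<And>x y. A y x = - A x y" and odd: "odd (length V + length W)"
  shows "pfl A (V @ c # W) * pfl A (d # a # V @ W @ [b]) - pfl A (d # V @ c # W @ [b]) * pfl A (a # V @ W) =
    pfl A (d # a # V @ c # W) * pfl A (V @ W @ [b]) - pfl A (a # V @ c # W @ [b]) * pfl A (d # V @ W)"
proof -
  let ?U = "V @ W"
  define s :: real where "s = (-1) ^ length W"
  have odd_power: "(-1) ^ length ?U = (-1::real)" using odd by simp
  have "pfl A (V @ c # W) = s * pfl A (?U @ [c])"
    using pfl_move[of V W "[]" A c] odd by (simp add: s_def)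
  moreover have "pfl A (d # a # ?U @ [b]) = pfl A (?U @ [d, a, b])"
    using pfl_move[of "[d]" ?U "[b]" A a] pfl_move[of "[]" ?U "[a, b]" A d] odd odd_power by simp
  moreover have "pfl A (d # V @ c # W @ [b]) = - s * pfl A (?U @ [d, c, b])"
    using pfl_move[of "d # V" W "[b]" A c] pfl_move[of "[]" ?U "[c, b]" A d] odd odd_power by (simp add: s_def)
  moreover have "pfl A (a # ?U) = - pfl A (?U @ [a])" "pfl A (d # ?U) = - pfl A (?U @ [d])"
    using pfl_move[of "[]" ?U "[]" A] odd odd_power by simp_all
  moreover have "pfl A (d # a # V @ c # W) = s * pfl A (?U @ [d, a, c])"
    using pfl_move[of "d # a # V" W "[]" A c] pfl_move[of "[d]" ?U "[c]" A a] pfl_move[of "[]" ?U "[a, c]" A d]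
      odd odd_power by (simp add: s_def)
  moreover have "pfl A (a # V @ c # W @ [b]) = - s * pfl A (?U @ [a, c, b])"
    using pfl_move[of "a # V" W "[b]" A c] pfl_move[of "[]" ?U "[c, b]" A a] odd odd_power by (simp add: s_def)
  moreover have "pfl A (?U @ [c, a, b]) = - pfl A (?U @ [a, c, b])"
    using pfl_swap[of ?U "[b]" A c a] odd by simp
  ultimately show ?thesis
    using arg_cong[OF pfl_relation_odd[of A ?U c d a b, OF skew], of "\<lambda>x. s * x"] odd
    by (simp add: algebra_simps)
qed

text \<open>With an even number of common labels, the products distribute the four special labels as
  2 + 2 or 0 + 4, where the odd case has 1 + 3.\<close>

lemma pfl_gap_relation_even:
  assumes skew: "\<And>x y. A y x = - A x y" and even: "even (length V + length W)"
  shows "pfl A (d # V @ c # W) * pfl A (a # V @ W @ [b]) - pfl A (V @ c # W @ [b]) * pfl A (d # a # V @ W) =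
    pfl A (a # V @ c # W) * pfl A (d # V @ W @ [b]) - pfl A (d # a # V @ c # W @ [b]) * pfl A (V @ W)"
proof -
  let ?U = "V @ W"
  define s :: real where "s = (-1) ^ length W"
  have even_power: "(-1) ^ length ?U = (1::real)" using even by simp
  have dc: "pfl A (x # V @ c # W) = s * pfl A (?U @ [x, c])" for x
    using pfl_move[of "x # V" W "[]" A c] pfl_move[of "[]" ?U "[c]" A x] even even_power by (simp add: s_def)
  moreover have "pfl A (x # V @ W @ [b]) = pfl A (?U @ [x, b])" for x
    using pfl_move[of "[]" ?U "[b]" A x] even even_power by simp
  moreover have "pfl A (V @ c # W @ [b]) = s * pfl A (?U @ [c, b])"
    using pfl_move[of V W "[b]" A c] even by (simp add: s_def)
  moreover have "pfl A (d # a # ?U) = pfl A (?U @ [d, a])"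
    using pfl_move[of "[d]" ?U "[]" A a] pfl_move[of "[]" ?U "[a]" A d] even even_power by simp
  moreover have "pfl A (d # a # V @ c # W @ [b]) = s * pfl A (?U @ [d, a, c, b])"
    using pfl_move[of "d # a # V" W "[b]" A c] pfl_move[of "[d]" ?U "[c, b]" A a] pfl_move[of "[]" ?U "[a, c, b]" A d]
      even even_power by (simp add: s_def)
  moreover have "pfl A (?U @ [d, a, c, b]) = pfl A (?U @ [a, b, c, d])"
    using pfl_move[of ?U "[a, c, b]" "[]" A d] pfl_swap[of "?U @ [a]" "[d]" A c b] even by simp
  ultimately show ?thesis
    using arg_cong[OF pfl_relation_even[of A ?U d c a b, OF skew], of "\<lambda>x. s * x"] even
    by (simp add: algebra_simps)
qed

section \<open>The two bilinear identities\<close>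

theorem mainTheorem6:
  fixes N :: nat
    and T :: "times set"
    and \<mu> :: "nat \<Rightarrow> nat \<Rightarrow> times \<Rightarrow> real"
    and \<beta> :: "nat \<Rightarrow> nat \<Rightarrow> times \<Rightarrow> real"
  assumes "N \<ge> 1"
    and "finitely_open T"
    and "\<And>i j t. t \<in> T \<Longrightarrow> \<mu> i j t = - \<mu> j i t"
    and "\<And>i j. smooth_in_times T (\<mu> i j)"
    and "\<And>k j. k \<in> {1..N} \<Longrightarrow> smooth_in_times T (\<beta> k j)"
    and "\<And>n i j t. n \<ge> 1 \<Longrightarrow> t \<in> T \<Longrightarrow>
           partial n (\<mu> i j) t = \<mu> (i + n) j t + \<mu> i (j + n) t"
    and "\<And>n k j t. n \<ge> 1 \<Longrightarrow> k \<in> {1..N} \<Longrightarrow> t \<in> T \<Longrightarrow>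
           partial n (\<beta> k j) t = \<beta> k (j + n) t"
    and "\<And>n m t. t \<in> T \<Longrightarrow> tau_even \<mu> \<beta> (2 * n) m t \<noteq> 0"
    and "\<And>n m k t. k \<in> {1..N} \<Longrightarrow> t \<in> T \<Longrightarrow> tau_odd \<mu> \<beta> k (2 * int n + 1) m t \<noteq> 0"
  shows "\<forall>n m. \<forall>k\<in>{1..N}. \<forall>l1\<le>2 * n + 1. \<forall>l2\<le>2 * n + 2. \<forall>t\<in>T.
      tau_even \<mu> \<beta> (2 * n) (m + 1) t
          * schur_op (2 * int n + 1 - int l1) (tau_odd \<mu> \<beta> k (2 * int n + 1) m) t
        + tau_odd \<mu> \<beta> k (2 * int n + 1) (m + 1) t
          * schur_op (2 * int n - int l1) (tau_even \<mu> \<beta> (2 * n) m) t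
      = tau_odd \<mu> \<beta> k (2 * int n + 1) m t
          * schur_op (2 * int n + 1 - int l1) (tau_even \<mu> \<beta> (2 * n) (m + 1)) t
        + tau_even \<mu> \<beta> (2 * n + 2) m t
          * schur_op (2 * int n - int l1) (tau_odd \<mu> \<beta> k (2 * int n - 1) (m + 1)) t
    \<and>
      tau_odd \<mu> \<beta> k (2 * int n + 1) (m + 1) t
          * schur_op (2 * int n + 2 - int l2) (tau_even \<mu> \<beta> (2 * n + 2) m) t
        + tau_even \<mu> \<beta> (2 * n + 2) (m + 1) t
          * schur_op (2 * int n + 1 - int l2) (tau_odd \<mu> \<beta> k (2 * int n + 1) m) t
      = tau_even \<mu> \<beta> (2 * n + 2) m t
          * schur_op (2 * int n + 2 - int l2) (tau_odd \<mu> \<beta> k (2 * int n + 1) (m + 1)) t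
        + tau_odd \<mu> \<beta> k (2 * int n + 3) m t
          * schur_op (2 * int n + 1 - int l2) (tau_even \<mu> \<beta> (2 * n) (m + 1)) t"
proof (intro allI ballI impI)
  note T = assms(2)
  have part: "(f has_field_derivative D) (at x)" if "f field_differentiable at x" "deriv f x = D"
    for f D and x :: real
    using that field_differentiable_derivI by blast
  \<comment> \<open>Smoothness for the empty list of derivatives gives differentiability of the
    moments, which turns an equation for \<open>deriv\<close> into a derivative in the proper
    sense.\<close>
  have \<mu>: "((\<lambda>x. \<mu> i j (t(l := x))) has_field_derivative \<mu> (i + l) j t + \<mu> i (j + l) t) (at (t l))"
    if "t \<in> T" "l \<ge> 1" for i j l t
    using assms(4)[of i j, unfolded smooth_in_times_def, rule_format, of "[]"] assms(6)[OF that(2,1), of i j] that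
    by (intro part) (auto simp: partial_def)
  have \<beta>: "((\<lambda>x. \<beta> k j (t(l := x))) has_field_derivative \<beta> k (j + l) t) (at (t l))"
    if "k \<in> {1..N}" "t \<in> T" "l \<ge> 1" for k j l t
    using assms(5)[OF that(1), of j, unfolded smooth_in_times_def, rule_format, of "[]"]
      assms(7)[OF that(3,1,2), of j] that
    by (intro part) (auto simp: partial_def)
  fix n m k l1 l2 :: nat and t :: times
  assume k: "k \<in> {1..N}" and l1: "l1 \<le> 2 * n + 1" and l2: "l2 \<le> 2 * n + 2" and t: "t \<in> T"
  define P where "P = pfl (pf_entry \<mu> \<beta> t)"
  define d where "d = Dlab k"
  have skew: "pf_entry \<mu> \<beta> t y x = - pf_entry \<mu> \<beta> t x y" for x y
  proof (cases x; cases y)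
    fix i j assume "x = Idx i" "y = Idx j"
    then show ?thesis using assms(3)[OF t, of j i] by simp
  qed simp_all
  have even: "tau_even \<mu> \<beta> r m t = P (map Idx [m..<m + r])" for r m
    by (simp add: tau_even_def P_def Pf_def pfl_def)
  have odd: "tau_odd \<mu> \<beta> k (int r) m t = P (d # map Idx [m..<m + r])" for r m
    by (simp add: tau_odd_def P_def Pf_def pfl_def d_def)
  have s_even: "schur_op (int j) (tau_even \<mu> \<beta> r m) t =
      (if j \<le> r then (-1) ^ j * P (map Idx (upt_gap m (m + r - j) (Suc (m + r)))) else 0)" if "even r" for j r m
    using schur_op_Pf[OF T \<mu>, of "[]" \<beta> r t j m] that t
    by (simp add: tau_even_def P_def Pf_def[abs_def] pfl_def)
  have s_odd: "schur_op (int j) (tau_odd \<mu> \<beta> k (int r) m) t =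
      (if j \<le> r then (-1) ^ j * P (d # map Idx (upt_gap m (m + r - j) (Suc (m + r)))) else 0)" if "odd r" for j r m
    using schur_op_Pf[OF T \<mu>, of "[Dlab k]" \<beta> r t j m] \<beta>[OF k] that t
    by (simp add: tau_odd_def P_def Pf_def[abs_def] pfl_def d_def)
  \<comment> \<open>A gap at the top leaves the original interval (order 0); a gap at the bottom
    shifts it by one (full order).\<close>
  have upt_gap_0: "upt_gap m (m + r) (Suc (m + r)) = [m..<m + r]" for m r
    by (simp add: upt_gap_def)
  have upt_gap_all: "upt_gap m m (Suc (m + r)) = [Suc m..<Suc (m + r)]" for m r
    by (simp add: upt_gap_def)
  have upt_mid: "[m..<q] = [m..<p] @ p # [Suc p..<q]" if "m \<le> p" "p < q" for m p q :: nat
    using that upt_add_eq_append[of m p "q - p"] by (simp add: upt_conv_Cons)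
  show "tau_even \<mu> \<beta> (2 * n) (m + 1) t
          * schur_op (2 * int n + 1 - int l1) (tau_odd \<mu> \<beta> k (2 * int n + 1) m) t
        + tau_odd \<mu> \<beta> k (2 * int n + 1) (m + 1) t
          * schur_op (2 * int n - int l1) (tau_even \<mu> \<beta> (2 * n) m) t
      = tau_odd \<mu> \<beta> k (2 * int n + 1) m t
          * schur_op (2 * int n + 1 - int l1) (tau_even \<mu> \<beta> (2 * n) (m + 1)) t
        + tau_even \<mu> \<beta> (2 * n + 2) m t
          * schur_op (2 * int n - int l1) (tau_odd \<mu> \<beta> k (2 * int n - 1) (m + 1)) t
    \<and>
      tau_odd \<mu> \<beta> k (2 * int n + 1) (m + 1) t
          * schur_op (2 * int n + 2 - int l2) (tau_even \<mu> \<beta> (2 * n + 2) m) t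
        + tau_even \<mu> \<beta> (2 * n + 2) (m + 1) t
          * schur_op (2 * int n + 1 - int l2) (tau_odd \<mu> \<beta> k (2 * int n + 1) m) t
      = tau_even \<mu> \<beta> (2 * n + 2) m t
          * schur_op (2 * int n + 2 - int l2) (tau_odd \<mu> \<beta> k (2 * int n + 1) (m + 1)) t
        + tau_odd \<mu> \<beta> k (2 * int n + 3) m t
          * schur_op (2 * int n + 1 - int l2) (tau_even \<mu> \<beta> (2 * n) (m + 1)) t"
    (is "?E1 \<and> ?E2")
  proof
    have r1: "2 * int n + 1 = int (2 * n + 1)" by simp
    have r3: "2 * int n + 3 = int (2 * n + 3)" by simp
    consider "l1 = 0" | "l1 = 2 * n + 1" | "1 \<le> l1" "l1 \<le> 2 * n" using l1 by linarith
    then show ?E1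
    proof cases
      case 1
      \<comment> \<open>On the left both operators have full order and shift their intervals to
        start at \<open>m + 1\<close>; orders of opposite parity make the two terms cancel. On the
        right the orders exceed the number of integer labels, so both terms vanish.\<close>
      have j: "2 * int n + 1 - int l1 = int (2 * n + 1)" "2 * int n - int l1 = int (2 * n)"
        using 1 by simp_all
      have "schur_op (int (2 * n)) (tau_odd \<mu> \<beta> k (2 * int n - 1) (m + 1)) t = 0"
      proof (cases "n = 0")
        case True
        then show ?thesis using schur_op_zero[OF T t] by (simp add: tau_odd_def)
      next
        case False
        then have "2 * int n - 1 = int (2 * n - 1)" by linarith
        then show ?thesis using s_odd[of "2 * n - 1" "2 * n" "m + 1"] False by simp
      qed
      then show ?thesis
        unfolding j unfolding r1 even odd using s_odd[of "2 * n + 1" "2 * n + 1" m]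
          s_even[of "2 * n" "2 * n" m] s_even[of "2 * n" "2 * n + 1" "m + 1"]
          upt_gap_all[of m "2 * n + 1"] upt_gap_all[of m "2 * n"]
        by (simp del: upt_Suc)
    next
      case 2
      have j: "2 * int n + 1 - int l1 = int 0" "2 * int n - int l1 = -1"
        using 2 by simp_all
      show ?thesis
        unfolding j unfolding r1 even odd using s_odd[of "2 * n + 1" 0 m]
          s_even[of "2 * n" 0 "m + 1"] upt_gap_0[of m "2 * n + 1"] upt_gap_0[of "m + 1" "2 * n"]
        by (simp add: schur_op_neg del: upt_Suc)
    next
      case 3
      \<comment> \<open>The operators have orders \<open>Suc j\<close> and \<open>j\<close>. Each
        order is matched to the end of its label interval, so that all four terms have their gap at
        the same label \<open>m + l1\<close>.\<close>
      define j where "j = 2 * n - l1"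
      have j: "2 * int n + 1 - int l1 = int (Suc j)" "2 * int n - int l1 = int j"
        and r: "2 * int n - 1 = int (2 * n - 1)"
        using 3 by (simp_all add: j_def)
      define V where "V = map Idx [m + 1..<m + l1]"
      define W where "W = map Idx [m + l1 + 1..<m + 2 * n + 1]"
      have len: "odd (length V + length W)" using 3 unfolding V_def W_def length_map length_upt by presburger
      have b: "[m + l1 + 1..<m + 2 * n + 2] = [m + l1 + 1..<m + 2 * n + 1] @ [m + 2 * n + 1]"
        using 3 by simp
      have a: "[m..<m + l1] = m # [m + 1..<m + l1]" using 3 by (simp add: upt_conv_Cons)
      have "map Idx [m + 1..<m + 1 + 2 * n] = V @ Idx (m + l1) # W"
        using 3 upt_mid[of "m + 1" "m + l1" "m + 2 * n + 1"] by (simp add: V_def W_def del: upt_Suc)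
      moreover have "map Idx [m + 1..<m + 1 + (2 * n + 1)] = V @ Idx (m + l1) # W @ [Idx (m + 2 * n + 1)]"
        using 3 upt_mid[of "m + 1" "m + l1" "m + 2 * n + 2"] b by (simp add: V_def W_def del: upt_Suc)
      moreover have "map Idx [m..<m + (2 * n + 1)] = Idx m # V @ Idx (m + l1) # W"
        using 3 upt_mid[of m "m + l1" "m + 2 * n + 1"] a by (simp add: V_def W_def del: upt_Suc)
      moreover have "map Idx [m..<m + (2 * n + 2)] = Idx m # V @ Idx (m + l1) # W @ [Idx (m + 2 * n + 1)]"
        using 3 upt_mid[of m "m + l1" "m + 2 * n + 2"] a b by (simp add: V_def W_def del: upt_Suc)
      moreover have "m + (2 * n + 1) - Suc j = m + l1" "m + 2 * n - j = m + l1"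
        "m + 1 + 2 * n - Suc j = m + l1" "m + 1 + (2 * n - 1) - j = m + l1"
        using 3 by (simp_all add: j_def)
      moreover have "map Idx (upt_gap m (m + l1) (Suc (m + (2 * n + 1)))) = Idx m # V @ W @ [Idx (m + 2 * n + 1)]"
        using a b by (simp add: upt_gap_def V_def W_def del: upt_Suc)
      moreover have "map Idx (upt_gap m (m + l1) (Suc (m + 2 * n))) = Idx m # V @ W"
        using a by (simp add: upt_gap_def V_def W_def del: upt_Suc)
      moreover have "map Idx (upt_gap (m + 1) (m + l1) (Suc (m + 1 + 2 * n))) = V @ W @ [Idx (m + 2 * n + 1)]"
        using b by (simp add: upt_gap_def V_def W_def del: upt_Suc)
      moreover have "map Idx (upt_gap (m + 1) (m + l1) (Suc (m + 1 + (2 * n - 1)))) = V @ W"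
        using 3 by (simp add: upt_gap_def V_def W_def del: upt_Suc)
      moreover have "Suc j \<le> 2 * n + 1" "j \<le> 2 * n" "Suc j \<le> 2 * n" "j \<le> 2 * n - 1" "even (2 * n)"
        "odd (2 * n + 1)" "odd (2 * n - 1)"
        using 3 by (simp_all add: j_def)
      \<comment> \<open>Orders \<open>Suc j\<close> and \<open>j\<close> give opposite signs. After
        removing the common factor \<open>(-1) ^ j\<close>, this is the pattern of minus signs in
        the gap relation.\<close>
      ultimately show ?thesis
        unfolding j unfolding r r1 even odd
        using arg_cong[OF pfl_gap_relation_odd[of "pf_entry \<mu> \<beta> t" V W "Idx (m + l1)" d "Idx m" "Idx (m + 2 * n + 1)", OF skew len, folded P_def],
          of "\<lambda>x. (-1) ^ j * x"]
        by (simp only: s_even s_odd if_True not_False_eq_True power_Suc) (simp add: algebra_simps)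
    qed
    consider "l2 = 0" | "l2 = 2 * n + 2" | "1 \<le> l2" "l2 \<le> 2 * n + 1" using l2 by linarith
    then show ?E2
    proof cases
      case 1
      \<comment> \<open>As for \<open>l1 = 0\<close>: two shifted products cancel on the left, and
        on the right both orders are too large by one.\<close>
      have j: "2 * int n + 2 - int l2 = int (2 * n + 2)" "2 * int n + 1 - int l2 = int (2 * n + 1)"
        using 1 by simp_all
      show ?thesis
        unfolding j unfolding r1 r3 even odd using s_even[of "2 * n + 2" "2 * n + 2" m] s_odd[of "2 * n + 1" "2 * n + 1" m]
          s_odd[of "2 * n + 1" "2 * n + 2" "m + 1"] s_even[of "2 * n" "2 * n + 1" "m + 1"]
          upt_gap_all[of m "2 * n + 1"] upt_gap_all[of m "2 * n + 2"]
        by (simp del: upt_Suc)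
    next
      case 2
      have j: "2 * int n + 2 - int l2 = int 0" "2 * int n + 1 - int l2 = -1"
        using 2 by simp_all
      show ?thesis
        unfolding j unfolding r1 r3 even odd using s_even[of "2 * n + 2" 0 m]
          s_odd[of "2 * n + 1" 0 "m + 1"] upt_gap_0[of m "2 * n + 2"] upt_gap_0[of "m + 1" "2 * n + 1"]
        by (simp add: schur_op_neg del: upt_Suc)
    next
      case 3
      define j where "j = 2 * n + 1 - l2"
      have j: "2 * int n + 2 - int l2 = int (Suc j)" "2 * int n + 1 - int l2 = int j"
        using 3 by (simp_all add: j_def)
      define V where "V = map Idx [m + 1..<m + l2]"
      define W where "W = map Idx [m + l2 + 1..<m + 2 * n + 2]"
      have len: "even (length V + length W)" using 3 unfolding V_def W_def length_map length_upt by presburger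
      have b: "[m + l2 + 1..<Suc (m + 2 * n + 2)] = [m + l2 + 1..<m + 2 * n + 2] @ [m + 2 * n + 2]"
        using 3 by simp
      have a: "[m..<m + l2] = m # [m + 1..<m + l2]" using 3 by (simp add: upt_conv_Cons)
      have "map Idx [m + 1..<m + 1 + (2 * n + 1)] = V @ Idx (m + l2) # W"
        using 3 upt_mid[of "m + 1" "m + l2" "m + 2 * n + 2"] by (simp add: V_def W_def del: upt_Suc)
      moreover have "map Idx [m + 1..<m + 1 + (2 * n + 2)] = V @ Idx (m + l2) # W @ [Idx (m + 2 * n + 2)]"
        using 3 upt_mid[of "m + 1" "m + l2" "Suc (m + 2 * n + 2)"] b by (simp add: V_def W_def del: upt_Suc)
      moreover have "map Idx [m..<m + (2 * n + 2)] = Idx m # V @ Idx (m + l2) # W"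
        using 3 upt_mid[of m "m + l2" "m + 2 * n + 2"] a by (simp add: V_def W_def del: upt_Suc)
      moreover have "map Idx [m..<m + (2 * n + 3)] = Idx m # V @ Idx (m + l2) # W @ [Idx (m + 2 * n + 2)]"
        using 3 upt_mid[of m "m + l2" "Suc (m + 2 * n + 2)"] a b by (simp add: numeral_3_eq_3 V_def W_def del: upt_Suc)
      moreover have "m + (2 * n + 2) - Suc j = m + l2" "m + (2 * n + 1) - j = m + l2"
        "m + 1 + (2 * n + 1) - Suc j = m + l2" "m + 1 + 2 * n - j = m + l2"
        using 3 by (simp_all add: j_def)
      moreover have "map Idx (upt_gap m (m + l2) (Suc (m + (2 * n + 2)))) = Idx m # V @ W @ [Idx (m + 2 * n + 2)]"
        using a b by (simp add: upt_gap_def V_def W_def del: upt_Suc)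
      moreover have "map Idx (upt_gap m (m + l2) (Suc (m + (2 * n + 1)))) = Idx m # V @ W"
        using a by (simp add: upt_gap_def V_def W_def del: upt_Suc)
      moreover have "map Idx (upt_gap (m + 1) (m + l2) (Suc (m + 1 + (2 * n + 1)))) = V @ W @ [Idx (m + 2 * n + 2)]"
        using b by (simp add: upt_gap_def V_def W_def del: upt_Suc)
      moreover have "map Idx (upt_gap (m + 1) (m + l2) (Suc (m + 1 + 2 * n))) = V @ W"
        by (simp add: upt_gap_def V_def W_def del: upt_Suc)
      moreover have "Suc j \<le> 2 * n + 2" "j \<le> 2 * n + 1" "Suc j \<le> 2 * n + 1" "j \<le> 2 * n" "even (2 * n)" "even (2 * n + 2)"
        "odd (2 * n + 1)"
        using 3 by (simp_all add: j_def)
      ultimately show ?thesis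
        unfolding j unfolding r1 r3 even odd
        using arg_cong[OF pfl_gap_relation_even[of "pf_entry \<mu> \<beta> t" V W d "Idx (m + l2)" "Idx m" "Idx (m + 2 * n + 2)", OF skew len, folded P_def],
          of "\<lambda>x. (-1) ^ j * x"]
        by (simp only: s_even s_odd if_True not_False_eq_True power_Suc) (simp add: algebra_simps)
    qed
  qed
qed

end
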